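(* Let $\delta:\subseteq\mathbb{N}^\mathbb{N}\to\mathrm{cord}$ be a representation (partial surjection) of the set $\mathrm{cord}$ of countable ordinals. Then the following are equivalent: (1) $\mathrm{id}:(\mathrm{cord},\delta)\to\mathbf{COrd}$ is a computable isomorphism (i.e. both $\mathrm{id}:(\mathrm{cord},\delta)\to\mathbf{COrd}$ and $\mathrm{id}:\mathbf{COrd}\to(\mathrm{cord},\delta)$ are computable). (2) All of the following are computable: (a) the point $0\in(\mathrm{cord},\delta)$; (b) $\alpha\mapsto\alpha+1:(\mathrm{cord},\delta)\to(\mathrm{cord},\delta)$; (c) $\sup:\mathcal{C}(\mathbb{N},(\mathrm{cord},\delta))\to(\mathrm{cord},\delta)$, $(\alpha_i)_{i}\mapsto\sup_i\alpha_i$; (d) $\mathrm{Lower}:(\mathrm{cord},\delta)\rightrightarrows\mathcal{C}(\mathbb{N},\{\mathrm{Skip}\}\uplus(\mathrm{cord},\delta))$.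
   Context: A represented space is a pair $\mathbf{X}=(X,\delta_\mathbf{X})$ with $\delta_\mathbf{X}:\subseteq\mathbb{N}^\mathbb{N}\to X$ a partial surjection; $p$ is a name of $\delta_\mathbf{X}(p)$. A partial multivalued $f:\subseteq\mathbf{X}\rightrightarrows\mathbf{Y}$ is computable (continuous) if it has a computable (continuous) realizer $F:\subseteq\mathbb{N}^\mathbb{N}\to\mathbb{N}^\mathbb{N}$, i.e. $\delta_\mathbf{Y}(F(p))\in f(\delta_\mathbf{X}(p))$ for all $p\in\mathrm{dom}(f\circ\delta_\mathbf{X})$. A point is computable if it has a computable name. $\mathcal{C}(\mathbf{X},\mathbf{Y})$ is the represented space of continuous functions $\mathbf{X}\to\mathbf{Y}$, where $0^n1p$ names $f$ iff the $n$-th oracle Turing machine with oracle $p$ computes a realizer of $f$; $\mathbb{N}$ carries its standard discrete representation. $\langle p_0,p_1,\ldots\rangle$ denotes a standard computable tupling of countably many elements of $\mathbb{N}^\mathbb{N}$. Let $\mathrm{cord}$ be the set of countable ordinals and $\mathbf{COrd}=(\mathrm{cord},\delta_{\mathrm{nK}})$, where $\delta_{\mathrm{nK}}$ is defined inductively by $\delta_{\mathrm{nK}}(0p)=0$, $\delta_{\mathrm{nK}}(1p)=\delta_{\mathrm{nK}}(p)+1$, $\delta_{\mathrm{nK}}(2\langle p_0,p_1,\ldots\rangle)=\sup_{i}\delta_{\mathrm{nK}}(p_i)$. The space $\{\mathrm{Skip}\}\uplus(\mathrm{cord},\delta)$ is the disjoint union of a singleton $\{\mathrm{Skip}\}$ and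 $(\mathrm{cord},\delta)$ (so $\mathcal{C}(\mathbb{N},\{\mathrm{Skip}\}\uplus(\mathrm{cord},\delta))$ is the space of partial sequences of ordinals). $\mathrm{Lower}$ is the multivalued map with $(\alpha_i)_{i\in\mathbb{N}}\in\mathrm{Lower}(\alpha)$ iff $\{\beta\in\mathrm{cord}\mid\beta<\alpha\}=\{\beta\in\mathrm{cord}\mid\exists i\in\mathbb{N}\ \alpha_i=\beta\}$. *)

theory Defs
  imports Complex_Main "HOL-Library.FuncSet" "HOL-Library.Nat_Bijection" "HOL-Library.Countable_Set"
begin

section \<open>Countable ordinals\<close>

text \<open>Order types of well-orders whose field is a subset of \<open>\<nat>\<close> (the field may be finite or empty).\<close>

quotient_type cord = "nat rel" / partial: "\<lambda>r s. (r, s) \<in> ordIso"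
proof (rule part_equivpI)
  have "Well_order ({} :: nat rel)"
    by simp
  then show "\<exists>r :: nat rel. (r, r) \<in> ordIso"
    using ordIso_reflexive by blast
  show "symp (\<lambda>r s :: nat rel. (r, s) \<in> ordIso)"
    by (auto intro: sympI ordIso_symmetric)
  show "transp (\<lambda>r s :: nat rel. (r, s) \<in> ordIso)"
    by (auto intro: transpI ordIso_transitive)
qed

instantiation cord :: linorder
begin

lift_definition less_eq_cord :: "cord \<Rightarrow> cord \<Rightarrow> bool" is "\<lambda>r s. (r, s) \<in> ordLeq"
  by (meson ordIso_ordLeq_trans ordIso_symmetric ordLeq_ordIso_trans)

lift_definition less_cord :: "cord \<Rightarrow> cord \<Rightarrow> bool" is "\<lambda>r s. (r, s) \<in> ordLess"
  by (meson ordIso_ordLess_trans ordIso_symmetric ordLess_ordIso_trans)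

lemma ordIso_selfD: "(r, r) \<in> ordIso \<Longrightarrow> Well_order r"
  by (simp add: ordIso_def)

instance
proof
  fix a b c :: cord
  show "a < b \<longleftrightarrow> a \<le> b \<and> \<not> b \<le> a"
    by transfer (metis not_ordLess_ordLeq ordIso_selfD ordLess_imp_ordLeq ordLess_or_ordLeq)
  show "a \<le> a"
    by transfer (simp add: ordIso_selfD ordLeq_reflexive)
  show "a \<le> b \<Longrightarrow> b \<le> c \<Longrightarrow> a \<le> c"
    by transfer (rule ordLeq_transitive)
  show "a \<le> b \<Longrightarrow> b \<le> a \<Longrightarrow> a = b"
    by transfer (simp add: ordIso_iff_ordLeq)
  show "a \<le> b \<or> b \<le> a"
    by transfer (simp add: ordIso_selfD ordLeq_total)
qed

end

lemma rep_cord_Well_order: "Well_order (rep_cord a)"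
  using Quotient_rep_reflp[OF Quotient_cord] by (rule ordIso_selfD)

lemma abs_rep_cord: "abs_cord (rep_cord a) = a"
  by (rule Quotient_abs_rep[OF Quotient_cord])

lemma rep_abs_cord: "Well_order r \<Longrightarrow> (rep_cord (abs_cord r), r) \<in> ordIso"
  using Quotient_rep_abs[OF Quotient_cord] ordIso_reflexive by blast

lemma less_cord_rep: "a < b \<longleftrightarrow> (rep_cord a, rep_cord b) \<in> ordLess"
  unfolding less_cord_def by simp

lemma less_eq_cord_rep: "a \<le> b \<longleftrightarrow> (rep_cord a, rep_cord b) \<in> ordLeq"
  unfolding less_eq_cord_def by simp

lemma wf_less_cord: "wf {(a, b :: cord). a < b}"
proof -
  have "{(a, b :: cord). a < b} = inv_image ordLess rep_cord"
    by (auto simp: less_cord_rep)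
  then show ?thesis
    by (simp add: wf_ordLess wf_inv_image)
qed

instance cord :: wellorder
proof
  fix P :: "cord \<Rightarrow> bool" and a :: cord
  assume "\<And>x. (\<And>y. y < x \<Longrightarrow> P y) \<Longrightarrow> P x"
  then show "P a"
    using wf_induct_rule[OF wf_less_cord, of P a] by auto
qed

instantiation cord :: conditionally_complete_linorder
begin

definition inf_cord :: "cord \<Rightarrow> cord \<Rightarrow> cord" where "inf_cord = min"
definition sup_cord :: "cord \<Rightarrow> cord \<Rightarrow> cord" where "sup_cord = max"
definition Inf_cord :: "cord set \<Rightarrow> cord" where "Inf_cord A = (LEAST a. a \<in> A)"
definition Sup_cord :: "cord set \<Rightarrow> cord" where "Sup_cord A = (LEAST b. \<forall>a\<in>A. a \<le> b)"

instance
proof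
  fix x z :: cord and A :: "cord set"
  show "Inf A \<le> x" if "x \<in> A"
    unfolding Inf_cord_def using that by (rule Least_le)
  show "z \<le> Inf A" if "A \<noteq> {}" "\<And>x. x \<in> A \<Longrightarrow> z \<le> x"
  proof -
    from that(1) obtain y where "y \<in> A" by blast
    then have "(LEAST a. a \<in> A) \<in> A" by (rule LeastI)
    with that(2) show ?thesis unfolding Inf_cord_def by blast
  qed
  show "x \<le> Sup A" if "x \<in> A" "bdd_above A"
  proof -
    from that(2) obtain y where "\<forall>a\<in>A. a \<le> y" unfolding bdd_above_def by blast
    then have "\<forall>a\<in>A. a \<le> (LEAST b. \<forall>a\<in>A. a \<le> b)" by (rule LeastI)
    with that(1) show ?thesis unfolding Sup_cord_def by blast
  qed
  show "Sup A \<le> z" if "A \<noteq> {}" "\<And>x. x \<in> A \<Longrightarrow> x \<le> z"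
    unfolding Sup_cord_def using that(2) by (intro Least_le) blast
qed (auto simp: inf_cord_def sup_cord_def)

end

instantiation cord :: zero
begin

lift_definition zero_cord :: cord is "{} :: nat rel"
  by (simp add: ordIso_reflexive)

instance ..

end

definition cord_succ :: "cord \<Rightarrow> cord" where
  "cord_succ a = (LEAST b. a < b)"

text \<open>
  The following facts show that the uses of \<open>LEAST\<close> above are meaningful: \<open>0\<close> is the least
  ordinal, every ordinal is the order type of the set of its predecessors, and countable sets are
  strictly bounded.
\<close>

lemma zero_le_cord: "0 \<le> (a :: cord)"
proof transfer
  fix r :: "nat rel"
  assume "(r, r) \<in> ordIso"
  then have "Well_order r"
    by (rule ordIso_selfD)
  then show "({} :: nat rel, r) \<in> ordLeq"
    unfolding ordLeq_def embed_def by simp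
qed

lemma cord_initial_segment:
  fixes b :: cord
  shows "\<exists>f. bij_betw f (Field (rep_cord b)) {..<b} \<and>
    (\<forall>x\<in>Field (rep_cord b). \<forall>y\<in>Field (rep_cord b). (x, y) \<in> rep_cord b \<longleftrightarrow> f x \<le> f y)"
proof -
  let ?r = "rep_cord b"
  let ?s = "\<lambda>x. Restr ?r (underS ?r x)"
  define f where "f x = abs_cord (?s x)" for x
  have wo: "Well_order ?r" by (rule rep_cord_Well_order)
  then have wr: "wo_rel ?r" by (simp add: wo_rel_def)
  have ws: "Well_order (?s x)" for x using wo by (rule Well_order_Restr)
  have iso: "(rep_cord (f x), ?s x) \<in> ordIso" for x
    unfolding f_def using ws by (rule rep_abs_cord)
  have lt: "f x < b" if "x \<in> Field ?r" for x
    using that iso wo unfolding less_cord_rep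
    by (metis ordIso_ordLess_trans ordIso_reflexive ordLess_iff_ordIso_Restr ws)
  have onto: "\<exists>x\<in>Field ?r. f x = c" if "c < b" for c
  proof -
    from that obtain x where x: "x \<in> Field ?r" "(rep_cord c, ?s x) \<in> ordIso"
      unfolding less_cord_rep
      using ordLess_iff_ordIso_Restr[OF wo rep_cord_Well_order] by blast
    then have "f x = c"
      by (metis abs_rep_cord f_def Quotient_rel_abs[OF Quotient_cord])
    with x show ?thesis by blast
  qed
  have mono: "f x < f y" if xy: "(x, y) \<in> ?r" "x \<noteq> y" for x y
  proof -
    have F: "x \<in> Field ?r" "y \<in> Field ?r" using xy by (auto simp: Field_def)
    have tr: "trans ?r" and an: "antisym ?r" using wo
      by (auto simp: well_order_on_def linear_order_on_def partial_order_on_def preorder_on_def)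
    have "underS ?r x \<subset> underS ?r y"
    proof
      show "underS ?r x \<subseteq> underS ?r y"
        using xy tr an unfolding underS_def
        by (smt (verit, best) antisymD mem_Collect_eq subsetI transD)
      show "underS ?r x \<noteq> underS ?r y" using xy by (auto simp: underS_def)
    qed
    then have "(?s x, ?s y) \<in> ordLess"
      using ofilter_subset_ordLess[OF wo, of "underS ?r x" "underS ?r y"]
        wo_rel.underS_ofilter[OF wr] by blast
    then show ?thesis
      unfolding less_cord_rep
      using ordIso_ordLess_trans[OF iso] ordLess_ordIso_trans[OF _ ordIso_symmetric[OF iso]] by blast
  qed
  have tot: "(x, y) \<in> ?r \<or> (y, x) \<in> ?r" if "x \<in> Field ?r" "y \<in> Field ?r" for x y
    using wo_rel.TOTALS[OF wr] that by blast
  have inj: "inj_on f (Field ?r)"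
    by (rule inj_onI) (metis less_irrefl mono tot)
  have "bij_betw f (Field ?r) {..<b}"
    unfolding bij_betw_def using inj lt onto by auto
  moreover have "(x, y) \<in> ?r \<longleftrightarrow> f x \<le> f y" if "x \<in> Field ?r" "y \<in> Field ?r" for x y
    using that mono tot by (metis less_le_not_le linorder_not_less order_refl)
  ultimately show ?thesis by blast
qed

lemma countable_cord_below: "countable {..<b :: cord}"
  using cord_initial_segment[of b]
  by (metis bij_betw_def countable_image countableI_type)

lemma cord_order_Well_order: "Well_order {(a, b :: cord). a \<le> b}"
proof -
  have "{(a, b :: cord). a \<le> b} - Id = {(a, b). a < b}" by auto
  moreover have "Field {(a, b :: cord). a \<le> b} = UNIV" by (auto simp: Field_def)
  ultimately show ?thesis
    using wf_less_cord
    by (auto simp: well_order_on_def linear_order_on_def partial_order_on_def preorder_on_def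
        refl_on_def trans_def antisym_def total_on_def)
qed

lemma uncountable_cord: "\<not> countable (UNIV :: cord set)"
proof
  assume "countable (UNIV :: cord set)"
  then obtain h :: "cord \<Rightarrow> nat" where h: "inj h"
    using countable_def by blast
  let ?R = "{(a, b :: cord). a \<le> b}"
  have F: "Field ?R = UNIV" by (auto simp: Field_def)
  let ?r = "dir_image ?R h"
  have r: "(?R, ?r) \<in> ordIso"
    using dir_image_ordIso[OF cord_order_Well_order] h F by simp
  then have wr: "Well_order ?r" by (simp add: ordIso_def)
  define c where "c = abs_cord ?r"
  have c: "(rep_cord c, ?R) \<in> ordIso"
    using rep_abs_cord[OF wr] r unfolding c_def
    by (meson ordIso_symmetric ordIso_transitive)
  obtain f where f: "bij_betw f (Field (rep_cord c)) {..<c}"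
    "\<forall>x\<in>Field (rep_cord c). \<forall>y\<in>Field (rep_cord c). (x, y) \<in> rep_cord c \<longleftrightarrow> f x \<le> f y"
    using cord_initial_segment by blast
  have us: "underS ?R c = {..<c}" by (auto simp: underS_def)
  let ?Q = "Restr ?R {..<c}"
  have FQ: "Field ?Q = {..<c}" by (auto simp: Field_def)
  have "iso (rep_cord c) ?Q f"
    unfolding iso_iff2 FQ using f by (auto simp: bij_betw_def)
  then have "(rep_cord c, ?Q) \<in> ordIso"
    unfolding ordIso_def
    using rep_cord_Well_order Well_order_Restr[OF cord_order_Well_order] by blast
  then have "(rep_cord c, ?R) \<in> ordLess"
    using ordLess_iff_ordIso_Restr[OF cord_order_Well_order rep_cord_Well_order] F us
    by (metis UNIV_I)
  with c show False by (meson not_ordLess_ordIso)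
qed

lemma countable_cord_bounded:
  fixes A :: "cord set"
  assumes "countable A"
  shows "\<exists>b. \<forall>a\<in>A. a < b"
proof (rule ccontr)
  assume "\<not> ?thesis"
  then have "(UNIV :: cord set) = (\<Union>a\<in>A. insert a {..<a})"
    by (force simp: not_less order.order_iff_strict)
  moreover have "countable (\<Union>a\<in>A. insert a {..<a})"
    using assms countable_cord_below by blast
  ultimately show False using uncountable_cord by simp
qed

lemma bdd_above_range_cord: "bdd_above (range (f :: nat \<Rightarrow> cord))"
  using countable_cord_bounded[of "range f"] by (meson bdd_above_def countableI_type countable_image less_imp_le)

lemma cord_succ_greater: "a < cord_succ a"
  unfolding cord_succ_def using countable_cord_bounded[of "{a}"] by (metis LeastI countable_insert countable_empty insertI1)

lemma cord_succ_least: "a < b \<Longrightarrow> cord_succ a \<le> b"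
  unfolding cord_succ_def by (rule Least_le)


section \<open>Computability on Baire space\<close>

type_synonym baire = "nat \<Rightarrow> nat"

definition prepend :: "nat \<Rightarrow> baire \<Rightarrow> baire" where
  "prepend a p = case_nat a p"

definition tail :: "baire \<Rightarrow> baire" where
  "tail p = (\<lambda>n. p (Suc n))"

definition join :: "baire \<Rightarrow> baire \<Rightarrow> baire" where
  "join p q = (\<lambda>n. if even n then p (n div 2) else q (n div 2))"

definition tuple :: "(nat \<Rightarrow> baire) \<Rightarrow> baire" where
  "tuple ps = (\<lambda>n. case prod_decode n of (i, k) \<Rightarrow> ps i k)"

text \<open>
  Oracle machines are programs for the functions partial recursive in an oracle, i.e. Kleene's
  schemes (basic functions, composition, primitive recursion, unbounded search) together with a
  query scheme. Tuples of arguments are coded by the Cantor pairing \<^const>\<open>prod_encode\<close>.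
\<close>

datatype prog =
    Zero | Succ | Fst | Snd | Query
  | Pair prog prog | Comp prog prog | PrimRec prog prog | Search prog

inductive computes :: "baire \<Rightarrow> prog \<Rightarrow> nat \<Rightarrow> nat \<Rightarrow> bool" for r :: baire where
  Zero: "computes r Zero x 0"
| Succ: "computes r Succ x (Suc x)"
| Fst: "computes r Fst (prod_encode (x, y)) x"
| Snd: "computes r Snd (prod_encode (x, y)) y"
| Query: "computes r Query x (r x)"
| Pair: "computes r f x y \<Longrightarrow> computes r g x z \<Longrightarrow> computes r (Pair f g) x (prod_encode (y, z))"
| Comp: "computes r g x y \<Longrightarrow> computes r f y z \<Longrightarrow> computes r (Comp f g) x z"
| PrimRec_0: "computes r f x y \<Longrightarrow> computes r (PrimRec f g) (prod_encode (x, 0)) y"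
| PrimRec_Suc:
    "computes r (PrimRec f g) (prod_encode (x, n)) y \<Longrightarrow>
     computes r g (prod_encode (x, prod_encode (n, y))) z \<Longrightarrow>
     computes r (PrimRec f g) (prod_encode (x, Suc n)) z"
| Search:
    "computes r f (prod_encode (x, n)) 0 \<Longrightarrow>
     (\<forall>m<n. \<exists>y. computes r f (prod_encode (x, m)) (Suc y)) \<Longrightarrow>
     computes r (Search f) x n"

text \<open>An effective enumeration of all programs.\<close>

lemma prod_decode_bounds [termination_simp]:
  "fst (prod_decode n) \<le> n" "snd (prod_decode n) \<le> n"
  using le_prod_encode_1[of "fst (prod_decode n)" "snd (prod_decode n)"]
    le_prod_encode_2[of "snd (prod_decode n)" "fst (prod_decode n)"] by simp_all

function nth_prog :: "nat \<Rightarrow> prog" where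
  "nth_prog n =
    (if n = 0 then Zero else if n = 1 then Succ else if n = 2 then Fst
     else if n = 3 then Snd else if n = 4 then Query
     else let m = (n - 5) div 4; a = nth_prog (fst (prod_decode m)); b = nth_prog (snd (prod_decode m)) in
       if (n - 5) mod 4 = 0 then Pair a b
       else if (n - 5) mod 4 = 1 then Comp a b
       else if (n - 5) mod 4 = 2 then PrimRec a b
       else Search (nth_prog m))"
  by pat_completeness auto
termination
proof (relation "measure id")
  have *: "(n - 5) div 4 < n" if "n \<noteq> 0" for n :: nat using that by linarith
  show "(fst (prod_decode m), n) \<in> measure id" "(snd (prod_decode m), n) \<in> measure id"
    "(m, n) \<in> measure id"
    if "n \<noteq> 0" "m = (n - 5) div 4" for m n
    using *[OF that(1)] that(2) prod_decode_bounds[of m] by auto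
qed auto

declare nth_prog.simps [simp del]

lemma nth_prog_Suc5:
  assumes "t < 4"
  shows "nth_prog (4 * prod_encode (i, j) + t + 5) =
    (if t = 0 then Pair (nth_prog i) (nth_prog j)
     else if t = 1 then Comp (nth_prog i) (nth_prog j)
     else if t = 2 then PrimRec (nth_prog i) (nth_prog j)
     else Search (nth_prog (prod_encode (i, j))))"
proof -
  have "(4 * m + t) div 4 = m" "(4 * m + t) mod 4 = t" for m using assms by auto
  then show ?thesis by (subst nth_prog.simps) (simp add: Let_def)
qed

lemma surj_nth_prog: "surj nth_prog"
proof -
  have "\<exists>n. nth_prog n = c" for c
  proof (induction c)
    case Zero
    show ?case by (rule exI[of _ 0]) (simp add: nth_prog.simps)
  next
    case Succ
    show ?case by (rule exI[of _ 1]) (simp add: nth_prog.simps)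
  next
    case Fst
    show ?case by (rule exI[of _ 2]) (simp add: nth_prog.simps)
  next
    case Snd
    show ?case by (rule exI[of _ 3]) (simp add: nth_prog.simps)
  next
    case Query
    show ?case by (rule exI[of _ 4]) (simp add: nth_prog.simps)
  next
    case (Pair f g)
    then show ?case using nth_prog_Suc5[of 0] by auto
  next
    case (Comp f g)
    then show ?case using nth_prog_Suc5[of 1] by auto
  next
    case (PrimRec f g)
    then show ?case using nth_prog_Suc5[of 2] by auto
  next
    case (Search f)
    then obtain n where "nth_prog n = f" by blast
    then show ?case using nth_prog_Suc5[of 3 "fst (prod_decode n)" "snd (prod_decode n)"] by auto
  qed
  then show ?thesis by (metis surj_def)
qed

text \<open>The partial function on Baire space computed by a program with the argument as oracle.\<close>

definition baire_fun :: "prog \<Rightarrow> baire \<rightharpoonup> baire" where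
  "baire_fun c r =
    (if \<forall>n. \<exists>y. computes r c n y then Some (\<lambda>n. THE y. computes r c n y) else None)"

text \<open>A computable function need not be undefined wherever the machine diverges outside its domain.\<close>

definition computable_baire_fun :: "(baire \<rightharpoonup> baire) \<Rightarrow> bool" where
  "computable_baire_fun F \<longleftrightarrow> (\<exists>c. F \<subseteq>\<^sub>m baire_fun c)"

definition computable_baire :: "baire \<Rightarrow> bool" where
  "computable_baire p \<longleftrightarrow> (\<exists>c. baire_fun c (\<lambda>_. 0) = Some p)"


section \<open>Represented spaces\<close>

text \<open>
  A represented space is given by its representation \<open>\<delta>\<close>; the underlying set is \<open>ran \<delta>\<close>, so that
  \<open>\<delta>\<close> is surjective onto it. Multivalued partial functions are set-valued functions, undefined
  where the value is empty.
\<close>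

type_synonym 'a representation = "baire \<rightharpoonup> 'a"

definition realizer ::
  "'a representation \<Rightarrow> 'b representation \<Rightarrow> ('a \<Rightarrow> 'b set) \<Rightarrow> (baire \<rightharpoonup> baire) \<Rightarrow> bool" where
  "realizer \<delta>X \<delta>Y f F \<longleftrightarrow>
    (\<forall>p x. \<delta>X p = Some x \<and> f x \<noteq> {} \<longrightarrow>
      (\<exists>q y. F p = Some q \<and> \<delta>Y q = Some y \<and> y \<in> f x))"

definition computable_multi ::
  "'a representation \<Rightarrow> 'b representation \<Rightarrow> ('a \<Rightarrow> 'b set) \<Rightarrow> bool" where
  "computable_multi \<delta>X \<delta>Y f \<longleftrightarrow> (\<exists>F. computable_baire_fun F \<and> realizer \<delta>X \<delta>Y f F)"

definition computable_map ::
  "'a representation \<Rightarrow> 'b representation \<Rightarrow> ('a \<Rightarrow> 'b) \<Rightarrow> bool" where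
  "computable_map \<delta>X \<delta>Y f \<longleftrightarrow> computable_multi \<delta>X \<delta>Y (\<lambda>x. {f x})"

definition computable_point :: "'a representation \<Rightarrow> 'a \<Rightarrow> bool" where
  "computable_point \<delta> x \<longleftrightarrow> (\<exists>p. computable_baire p \<and> \<delta> p = Some x)"

definition rep_nat :: "nat representation" where
  "rep_nat p = Some (p 0)"

definition rep_unit :: "unit representation" where
  "rep_unit p = Some ()"

definition rep_sum :: "'a representation \<Rightarrow> 'b representation \<Rightarrow> ('a + 'b) representation" where
  "rep_sum \<delta>X \<delta>Y p =
    (if p 0 = 0 then map_option Inl (\<delta>X (tail p))
     else if p 0 = 1 then map_option Inr (\<delta>Y (tail p))
     else None)"

abbreviation Skip :: "unit + 'a" where
  "Skip \<equiv> Inl ()"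

text \<open>
  \<open>0\<^sup>n1p\<close> names the function realized by the \<open>n\<close>-th machine with oracle \<open>p\<close>, which on input \<open>q\<close>
  has access to both \<open>p\<close> and \<open>q\<close>. Functions are made \<^const>\<open>extensional\<close> so that a name determines
  the function even if the underlying set of the domain is not the whole type.
\<close>

definition names_fun ::
  "'a representation \<Rightarrow> 'b representation \<Rightarrow> baire \<Rightarrow> ('a \<Rightarrow> 'b) \<Rightarrow> bool" where
  "names_fun \<delta>X \<delta>Y r f \<longleftrightarrow>
    f \<in> extensional (ran \<delta>X) \<and>
    (\<exists>n p. r = (prepend 0 ^^ n) (prepend 1 p) \<and>
      realizer \<delta>X \<delta>Y (\<lambda>x. {f x}) (\<lambda>q. baire_fun (nth_prog n) (join p q)))"

definition rep_fun :: "'a representation \<Rightarrow> 'b representation \<Rightarrow> ('a \<Rightarrow> 'b) representation" where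
  "rep_fun \<delta>X \<delta>Y r =
    (if \<exists>f. names_fun \<delta>X \<delta>Y r f then Some (THE f. names_fun \<delta>X \<delta>Y r f) else None)"


section \<open>The space of countable ordinals\<close>

inductive nK_name :: "baire \<Rightarrow> cord \<Rightarrow> bool" where
  zero: "nK_name (prepend 0 p) 0"
| succ: "nK_name p a \<Longrightarrow> nK_name (prepend 1 p) (cord_succ a)"
| sup: "(\<And>i. nK_name (ps i) (a i)) \<Longrightarrow> nK_name (prepend 2 (tuple ps)) (SUP i. a i)"

definition \<delta>_nK :: "cord representation" where
  "\<delta>_nK p = (if \<exists>a. nK_name p a then Some (THE a. nK_name p a) else None)"

definition Lower :: "cord \<Rightarrow> (nat \<Rightarrow> unit + cord) set" where
  "Lower a = {s. {b. b < a} = {b. \<exists>i. s i = Inr b}}"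

text \<open>The relations behind the definite descriptions above are single-valued.\<close>

lemma computes_deterministic:
  "computes r c x y \<Longrightarrow> computes r c x z \<Longrightarrow> y = z"
proof (induction arbitrary: z rule: computes.induct)
  case (Pair f x y g z)
  from Pair.prems show ?case by cases (auto dest: Pair.IH)
next
  case (Comp g x y f z)
  from Comp.prems show ?case by cases (auto dest: Comp.IH)
next
  case (PrimRec_0 f x y g)
  from PrimRec_0.prems show ?case by cases (auto dest: PrimRec_0.IH)
next
  case (PrimRec_Suc f g x n y z)
  from PrimRec_Suc.prems show ?case by cases (auto dest: PrimRec_Suc.IH)
next
  case (Search f x n)
  have low: False if "m < n" "computes r f (prod_encode (x, m)) 0" for m
    using that Search.IH(2) by blast
  from Search.prems have z: "computes r f (prod_encode (x, z)) 0"
    "\<forall>m<z. \<exists>y. computes r f (prod_encode (x, m)) (Suc y)"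
    by (cases, simp)+
  have "\<not> n < z" using z(2) Search.IH(1) by blast
  with low z(1) show ?case by (meson linorder_neqE_nat)
qed (erule computes.cases; simp)+

lemma prepend_eq_iff [simp]: "prepend a p = prepend b q \<longleftrightarrow> a = b \<and> p = q"
  unfolding prepend_def fun_eq_iff by (auto split: nat.splits)

lemma tuple_eq_iff [simp]: "tuple ps = tuple qs \<longleftrightarrow> ps = qs"
proof
  assume "tuple ps = tuple qs"
  then have "tuple ps (prod_encode (i, k)) = tuple qs (prod_encode (i, k))" for i k by simp
  then show "ps = qs" by (auto simp: tuple_def fun_eq_iff)
qed simp

lemma nK_name_unique: "nK_name p a \<Longrightarrow> nK_name p b \<Longrightarrow> a = b"
proof (induction arbitrary: b rule: nK_name.induct)
  case (sup ps a)
  from sup.prems show ?case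
  proof cases
    case (sup qs a')
    then have "a i = a' i" for i using sup.IH by simp
    then show ?thesis using sup by presburger
  qed simp_all
qed (erule nK_name.cases; auto)+

lemma names_fun_unique:
  assumes "names_fun \<delta>X \<delta>Y r f" "names_fun \<delta>X \<delta>Y r g"
  shows "f = g"
proof -
  have inj: "n = m \<and> p = q"
    if "(prepend 0 ^^ n) (prepend 1 p) = (prepend 0 ^^ m) (prepend 1 q)" for n m p q
    using that by (induction n arbitrary: m) (case_tac m; auto)+
  show ?thesis
  proof (rule extensionalityI)
    show "f \<in> extensional (ran \<delta>X)" "g \<in> extensional (ran \<delta>X)"
      using assms by (auto simp: names_fun_def)
    fix x
    assume "x \<in> ran \<delta>X"
    then obtain q where q: "\<delta>X q = Some x" by (auto simp: ran_def)
    obtain n p where f: "r = (prepend 0 ^^ n) (prepend 1 p)"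
      "realizer \<delta>X \<delta>Y (\<lambda>x. {f x}) (\<lambda>q. baire_fun (nth_prog n) (join p q))"
      using assms(1) by (auto simp: names_fun_def)
    obtain m p' where g: "r = (prepend 0 ^^ m) (prepend 1 p')"
      "realizer \<delta>X \<delta>Y (\<lambda>x. {g x}) (\<lambda>q. baire_fun (nth_prog m) (join p' q))"
      using assms(2) by (auto simp: names_fun_def)
    have "n = m" "p = p'" using inj f(1) g(1) by metis+
    with f(2) g(2) q show "f x = g x"
      unfolding realizer_def by fastforce
  qed
qed

end

theory Submission
  imports Defs
begin

text \<open>
  The operations of (2) for \<open>\<delta>_nK\<close> are immediate except for \<^const>\<open>Lower\<close>, which satisfies the
  recursion \<open>Lower 0 = {}\<close>, \<open>Lower (a + 1) = Lower a \<union> {a}\<close>,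
  \<open>Lower (SUP i. a i) = (\<Union>i. Lower (a i))\<close>; an isomorphism transports them to \<open>\<delta>\<close>.
  Conversely, given (2), a \<open>\<delta>_nK\<close>-name is translated recursively by applying the given
  zero, successor and supremum, and a \<open>\<delta>\<close>-name of \<open>a\<close> is translated recursively by means of
  \<open>a = SUP {b + 1 | b \<in> Lower a}\<close>. All these recursions are realized by programs which find their
  own index in the first entry of the oracle and run it with a universal program. They need to be
  correct only on names of ordinals, where they terminate by transfinite induction.
\<close>

section \<open>Programs\<close>

inductive_cases computes_elims:
  "computes r Zero x y" "computes r Succ x y" "computes r Fst x y" "computes r Snd x y"
  "computes r Query x y" "computes r (Pair f g) x y" "computes r (Comp f g) x y"
  "computes r (PrimRec f g) x y" "computes r (Search f) x y"

text \<open>The schemes contain no identity. The Cantor pairing is a bijection, so taking any number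
  apart and pairing its components again returns it.\<close>

abbreviation prog_id :: prog where
  "prog_id \<equiv> Pair Fst Snd"

lemma computes_Fst: "computes r Fst z (fst (prod_decode z))"
  by (metis computes.Fst prod.collapse prod_decode_inverse)

lemma computes_Snd: "computes r Snd z (snd (prod_decode z))"
  by (metis computes.Snd prod.collapse prod_decode_inverse)

lemma computes_id: "computes r prog_id x x"
  using computes.Pair[OF computes_Fst[of r x] computes_Snd[of r x]] by simp

section \<open>Total functions of oracle and argument, and their closure properties\<close>

text \<open>One program has to serve all oracles and halt on all arguments. Partiality never arises
  at this level, so computability of an explicit term follows its syntax.\<close>

definition computable_op :: "(baire \<Rightarrow> nat \<Rightarrow> nat) \<Rightarrow> bool" where
  "computable_op f \<longleftrightarrow> (\<exists>c. \<forall>r x. computes r c x (f r x))"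

lemma computable_opI: "(\<And>r x. computes r c x (f r x)) \<Longrightarrow> computable_op f"
  unfolding computable_op_def by blast

lemma computable_op_id: "computable_op (\<lambda>r x. x)"
  by (rule computable_opI computes_id)+

lemma computable_op_comp: "computable_op f \<Longrightarrow> computable_op g \<Longrightarrow> computable_op (\<lambda>r x. f r (g r x))"
  unfolding computable_op_def by (meson computes.Comp)

lemma computable_op_Suc: "computable_op f \<Longrightarrow> computable_op (\<lambda>r x. Suc (f r x))"
  unfolding computable_op_def by (meson computes.Comp computes.Succ)

lemma computable_op_query: "computable_op f \<Longrightarrow> computable_op (\<lambda>r x. r (f r x))"
  unfolding computable_op_def by (meson computes.Comp computes.Query)

lemma computable_op_fst: "computable_op f \<Longrightarrow> computable_op (\<lambda>r x. fst (prod_decode (f r x)))"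
  unfolding computable_op_def by (meson computes.Comp computes_Fst)

lemma computable_op_snd: "computable_op f \<Longrightarrow> computable_op (\<lambda>r x. snd (prod_decode (f r x)))"
  unfolding computable_op_def by (meson computes.Comp computes_Snd)

lemma computable_op_pair: "computable_op f \<Longrightarrow> computable_op g \<Longrightarrow> computable_op (\<lambda>r x. prod_encode (f r x, g r x))"
  unfolding computable_op_def by (meson computes.Pair)

lemma computable_op_const: "computable_op (\<lambda>r x. k)"
proof (induction k)
  case 0
  show ?case by (rule computable_opI computes.Zero)+
qed (rule computable_op_Suc)

text \<open>The assumption on \<open>g\<close> is phrased with projections because
  \<open>PrimRec\<close> hands its step program the nested code of parameter, counter and previous
  value.\<close>

lemma computable_op_rec:
  assumes "computable_op f"
    and "computable_op (\<lambda>r z. g r (fst (prod_decode z)) (fst (prod_decode (snd (prod_decode z))))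
      (snd (prod_decode (snd (prod_decode z)))))"
    and "computable_op n"
  shows "computable_op (\<lambda>r x. rec_nat (f r x) (g r x) (n r x))"
proof -
  obtain c where c: "computes r c x (f r x)" for r x
    using assms(1) unfolding computable_op_def by blast
  obtain d where d: "computes r d z (g r (fst (prod_decode z))
      (fst (prod_decode (snd (prod_decode z)))) (snd (prod_decode (snd (prod_decode z)))))" for r z
    using assms(2) unfolding computable_op_def by blast
  have "computes r (PrimRec c d) (prod_encode (x, k)) (rec_nat (f r x) (g r x) k)" for r x k
  proof (induction k)
    case (Suc k)
    have "computes r d (prod_encode (x, prod_encode (k, rec_nat (f r x) (g r x) k)))
        (rec_nat (f r x) (g r x) (Suc k))"
      using d[of r "prod_encode (x, prod_encode (k, rec_nat (f r x) (g r x) k))"] by simp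
    with Suc show ?case by (rule computes.PrimRec_Suc)
  qed (simp add: computes.PrimRec_0 c)
  \<comment> \<open>Every \<open>z\<close> is the code of a pair, so the program works on all
    inputs; composing with the pair of \<open>x\<close> and \<open>n r x\<close> then sets the
    counter.\<close>
  then have "computable_op (\<lambda>r z. rec_nat (f r (fst (prod_decode z))) (g r (fst (prod_decode z))) (snd (prod_decode z)))"
    by (intro computable_opI[of "PrimRec c d"]) (metis prod.collapse prod_decode_inverse)
  from computable_op_comp[OF this computable_op_pair[OF computable_op_id assms(3)]] show ?thesis by simp
qed

lemma computable_op_if_0:
  assumes "computable_op n" "computable_op f" "computable_op g"
  shows "computable_op (\<lambda>r x. if n r x = 0 then f r x else g r x)"
proof -
  have "(if k = 0 then a else b) = rec_nat a (\<lambda>_ _. b) k" for k a b :: nat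
    by (cases k) auto
  then show ?thesis
    using computable_op_rec[OF assms(2) computable_op_comp[OF assms(3) computable_op_fst[OF computable_op_id]] assms(1)] by simp
qed

lemma computable_op_pred:
  assumes "computable_op n"
  shows "computable_op (\<lambda>r x. n r x - 1)"
proof -
  have "k - 1 = rec_nat 0 (\<lambda>k _. k) k" for k :: nat
    by (cases k) auto
  then show ?thesis
    by (simp only:) (intro computable_op_rec computable_op_const assms computable_op_fst computable_op_snd computable_op_id)
qed

lemma computable_op_plus:
  assumes "computable_op f" "computable_op g"
  shows "computable_op (\<lambda>r x. f r x + g r x)"
proof -
  have "a + k = rec_nat a (\<lambda>_ y. Suc y) k" for a k :: nat
    by (induction k) auto
  then show ?thesis
    by (simp only:) (intro computable_op_rec computable_op_Suc assms computable_op_snd computable_op_id)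
qed

lemma computable_op_double: "computable_op f \<Longrightarrow> computable_op (\<lambda>r x. 2 * f r x)"
  unfolding mult_2 by (intro computable_op_plus)

lemma computable_op_minus:
  assumes "computable_op f" "computable_op g"
  shows "computable_op (\<lambda>r x. f r x - g r x)"
proof -
  have "rec_nat a (\<lambda>_ y. y - 1) k = a - k" for a k :: nat
    by (induction k) auto
  moreover have "computable_op (\<lambda>r x. rec_nat (f r x) (\<lambda>_ y. y - 1) (g r x))"
    by (intro computable_op_rec computable_op_pred assms computable_op_snd computable_op_id)
  ultimately show ?thesis by simp
qed

lemma computable_op_if_eq:
  assumes "computable_op f" "computable_op g" "computable_op h" "computable_op k"
  shows "computable_op (\<lambda>r x. if f r x = g r x then h r x else k r x)"
proof -
  have "computable_op (\<lambda>r x. if (f r x - g r x) + (g r x - f r x) = 0 then h r x else k r x)"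
    by (intro computable_op_if_0 computable_op_plus computable_op_minus assms)
  moreover have "(a - b) + (b - a) = 0 \<longleftrightarrow> a = b" for a b :: nat by auto
  ultimately show ?thesis by simp
qed

lemma computable_op_mod:
  assumes "computable_op f"
  shows "computable_op (\<lambda>r x. f r x mod d)"
proof -
  have "k mod d = rec_nat 0 (\<lambda>_ y. if Suc y = d then 0 else Suc y) k" for k
    by (induction k) (auto simp: mod_Suc)
  then show ?thesis
    by (simp only:) (intro computable_op_rec computable_op_if_eq computable_op_const computable_op_Suc assms computable_op_snd computable_op_id)
qed

lemma computable_op_div:
  assumes "computable_op f"
  shows "computable_op (\<lambda>r x. f r x div d)"
proof -
  have "k div d = rec_nat 0 (\<lambda>k y. if Suc k mod d = 0 then Suc y else y) k" for k
    by (induction k) (auto simp: div_Suc)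
  then show ?thesis
    by (simp only:) (intro computable_op_rec computable_op_if_0 computable_op_mod computable_op_const computable_op_Suc assms computable_op_fst computable_op_snd computable_op_id)
qed

lemma computable_op_if_even:
  assumes "computable_op n" "computable_op f" "computable_op g"
  shows "computable_op (\<lambda>r x. if even (n r x) then f r x else g r x)"
  unfolding even_iff_mod_2_eq_zero by (intro computable_op_if_0 computable_op_mod assms)

lemma computable_op_prepend:
  assumes "computable_op (\<lambda>r x. a r)" "computable_op p"
  shows "computable_op (\<lambda>r x. prepend (a r) (p r) x)"
proof -
  have "prepend b q x = (if x = 0 then b else q (x - 1))" for b q x
    by (cases x) (auto simp: prepend_def)
  then show ?thesis
    by (simp only:) (intro computable_op_if_0 computable_op_id assms(1) computable_op_comp[OF assms(2)] computable_op_pred)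
qed

lemma computable_op_tail:
  assumes "computable_op p"
  shows "computable_op (\<lambda>r x. tail (p r) x)"
  unfolding tail_def by (intro computable_op_comp[OF assms] computable_op_Suc computable_op_id)

lemma computable_op_join:
  assumes "computable_op p" "computable_op q"
  shows "computable_op (\<lambda>r x. join (p r) (q r) x)"
  unfolding join_def
  by (intro computable_op_if_even computable_op_id computable_op_comp[OF assms(1)] computable_op_comp[OF assms(2)] computable_op_div)

lemma computable_op_oracle: "computable_op (\<lambda>r x. r x)"
  by (intro computable_op_query computable_op_id)

lemmas computable_op_intros = computable_op_const computable_op_id computable_op_oracle computable_op_fst computable_op_snd computable_op_pair computable_op_if_0
  computable_op_if_eq computable_op_if_even computable_op_mod computable_op_div computable_op_pred computable_op_plus computable_op_minus computable_op_prepend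
  computable_op_tail computable_op_join computable_op_Suc computable_op_double computable_op_query

text \<open>The parameter \<open>i\<close> allows the substituted oracle to vary with the input.\<close>

lemma oracle_substitution:
  "\<exists>c'. \<forall>r i s x y. (\<forall>z. computes r d (prod_encode (i, z)) (s z)) \<longrightarrow> computes s c x y \<longrightarrow>
    computes r c' (prod_encode (i, x)) y"
proof (induction c)
  case Zero
  show ?case by (rule exI[of _ Zero]) (auto elim: computes_elims intro: computes.Zero)
next
  case Succ
  show ?case
    by (rule exI[of _ "Comp Succ Snd"]) (auto elim!: computes_elims intro!: computes.intros)
next
  case Fst
  show ?case
    by (rule exI[of _ "Comp Fst Snd"]) (auto elim!: computes_elims intro!: computes.intros)
next
  case Snd
  show ?case
    by (rule exI[of _ "Comp Snd Snd"]) (auto elim!: computes_elims intro!: computes.intros)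
next
  case Query
  \<comment> \<open>A query to \<open>s\<close> is answered by \<open>d\<close>, which already
    expects the parameter in front.\<close>
  show ?case by (rule exI[of _ d]) (auto elim!: computes_elims)
next
  case (Pair f g)
  then obtain f' g' where
    "\<And>r i s x y. (\<forall>z. computes r d (prod_encode (i, z)) (s z)) \<Longrightarrow> computes s f x y \<Longrightarrow>
      computes r f' (prod_encode (i, x)) y"
    "\<And>r i s x y. (\<forall>z. computes r d (prod_encode (i, z)) (s z)) \<Longrightarrow> computes s g x y \<Longrightarrow>
      computes r g' (prod_encode (i, x)) y"
    by metis
  then show ?case
    by (intro exI[of _ "Pair f' g'"]) (auto elim!: computes_elims intro!: computes.Pair)
next
  case (Comp f g)
  then obtain f' g' where f':
    "\<And>r i s x y. (\<forall>z. computes r d (prod_encode (i, z)) (s z)) \<Longrightarrow> computes s f x y \<Longrightarrow>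
      computes r f' (prod_encode (i, x)) y" and g':
    "\<And>r i s x y. (\<forall>z. computes r d (prod_encode (i, z)) (s z)) \<Longrightarrow> computes s g x y \<Longrightarrow>
      computes r g' (prod_encode (i, x)) y"
    by metis
  have "computes r (Comp f' (Pair Fst g')) (prod_encode (i, x)) y"
    if "\<forall>z. computes r d (prod_encode (i, z)) (s z)" "computes s (Comp f g) x y" for r i s x y
    using that(2) by cases (meson computes.Comp computes.Pair computes.Fst f' g' that(1))
  then show ?case by blast
next
  case (PrimRec f g)
  then obtain f' g' where f':
    "\<And>r i s x y. (\<forall>z. computes r d (prod_encode (i, z)) (s z)) \<Longrightarrow> computes s f x y \<Longrightarrow>
      computes r f' (prod_encode (i, x)) y" and g':
    "\<And>r i s x y. (\<forall>z. computes r d (prod_encode (i, z)) (s z)) \<Longrightarrow> computes s g x y \<Longrightarrow>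
      computes r g' (prod_encode (i, x)) y"
    by metis
  \<comment> \<open>\<open>PrimRec\<close> and \<open>Search\<close> count in the outer second
    component, so \<open>i\<close> and \<open>x\<close> are grouped into one parameter and the input
    becomes \<open>((i, x), n)\<close>; \<open>G\<close> regroups \<open>((i, x), w)\<close> to
    \<open>(i, (x, w))\<close>, the form \<open>g'\<close> expects.\<close>
  define G where "G = Comp g' (Pair (Comp Fst Fst) (Pair (Comp Snd Fst) Snd))"
  define c' where "c' = Comp (PrimRec f' G) (Pair (Pair Fst (Comp Fst Snd)) (Comp Snd Snd))"
  have G: "computes r G (prod_encode (prod_encode (i, x), w)) y"
    if "computes r g' (prod_encode (i, prod_encode (x, w))) y" for r i x w y
    unfolding G_def using that by (meson computes.intros)
  have rec: "computes r (PrimRec f' G) (prod_encode (prod_encode (i, x), n)) y"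
    if "\<forall>z. computes r d (prod_encode (i, z)) (s z)"
      "computes s (PrimRec f g) (prod_encode (x, n)) y" for r i s x n y
    using that(2)
  proof (induction n arbitrary: y)
    case 0
    then show ?case by cases (auto intro!: computes.PrimRec_0 f'[OF that(1)])
  next
    case (Suc n)
    from Suc.prems show ?case
      by cases (auto intro!: computes.PrimRec_Suc[OF Suc.IH] G g'[OF that(1)])
  qed
  have "computes r c' (prod_encode (i, x)) y"
    if "\<forall>z. computes r d (prod_encode (i, z)) (s z)" "computes s (PrimRec f g) x y" for r i s x y
  proof -
    obtain a n where x: "x = prod_encode (a, n)" by (metis prod_decode_inverse surj_pair)
    show ?thesis
      using rec[OF that(1), of a n y] that(2) unfolding c'_def x by (meson computes.intros)
  qed
  then show ?case by blast
next
  case (Search f)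
  then obtain f' where f':
    "\<And>r i s x y. (\<forall>z. computes r d (prod_encode (i, z)) (s z)) \<Longrightarrow> computes s f x y \<Longrightarrow>
      computes r f' (prod_encode (i, x)) y"
    by metis
  define F where "F = Comp f' (Pair (Comp Fst Fst) (Pair (Comp Snd Fst) Snd))"
  have F: "computes r F (prod_encode (prod_encode (i, x), n)) y"
    if "\<forall>z. computes r d (prod_encode (i, z)) (s z)" "computes s f (prod_encode (x, n)) y"
    for r i s x n y
    unfolding F_def using f'[OF that] by (meson computes.intros)
  have "computes r (Search F) (prod_encode (i, x)) y"
    if "\<forall>z. computes r d (prod_encode (i, z)) (s z)" "computes s (Search f) x y" for r i s x y
    using that(2) by cases (meson computes.Search F[OF that(1)])
  then show ?case by blast
qed

section \<open>A universal program\<close>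

text \<open>
  A stack machine for programs given by their index. A stack is \<open>0\<close> or \<open>push\<close> of a frame, which
  records what to do with the value returned by the current evaluation.
\<close>

definition ev :: "nat \<Rightarrow> nat \<Rightarrow> nat \<Rightarrow> nat" where
  "ev K n x = prod_encode (0, prod_encode (K, prod_encode (n, x)))"

definition ret :: "nat \<Rightarrow> nat \<Rightarrow> nat" where
  "ret K y = prod_encode (1, prod_encode (K, y))"

definition push :: "nat \<Rightarrow> nat \<Rightarrow> nat \<Rightarrow> nat \<Rightarrow> nat" where
  "push t a b K = Suc (prod_encode (prod_encode (t, prod_encode (a, b)), K))"

text \<open>The tests mirror the index arithmetic of \<open>nth_prog\<close>. A primitive recursion
  at a successor evaluates the same index at the predecessor and leaves its step program in a frame;
  a search starts with candidate 0.\<close>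

definition step_ev :: "baire \<Rightarrow> nat \<Rightarrow> nat \<Rightarrow> nat \<Rightarrow> nat" where
  "step_ev r K n x =
    (if n = 0 then ret K 0 else if n = 1 then ret K (Suc x)
     else if n = 2 then ret K (fst (prod_decode x))
     else if n = 3 then ret K (snd (prod_decode x)) else if n = 4 then ret K (r x)
     else if (n - 5) mod 4 = 0 then
       ev (push 0 (snd (prod_decode ((n - 5) div 4))) x K) (fst (prod_decode ((n - 5) div 4))) x
     else if (n - 5) mod 4 = 1 then
       ev (push 1 (fst (prod_decode ((n - 5) div 4))) 0 K) (snd (prod_decode ((n - 5) div 4))) x
     else if (n - 5) mod 4 = 2 then
       (if snd (prod_decode x) = 0 then ev K (fst (prod_decode ((n - 5) div 4))) (fst (prod_decode x))
        else ev (push 2 (snd (prod_decode ((n - 5) div 4)))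
              (prod_encode (fst (prod_decode x), snd (prod_decode x) - 1)) K)
            n (prod_encode (fst (prod_decode x), snd (prod_decode x) - 1)))
     else ev (push 3 ((n - 5) div 4) (prod_encode (x, 0)) K) ((n - 5) div 4) (prod_encode (x, 0)))"

text \<open>Pending work by tag: 0 evaluates the second half of a pair, 1 the outer part of a
  composition, 2 the step of a primitive recursion; 3 tests the value at a search candidate; 4 holds
  the finished first half of a pair.\<close>

definition step_frame :: "nat \<Rightarrow> nat \<Rightarrow> nat \<Rightarrow> nat \<Rightarrow> nat \<Rightarrow> nat" where
  "step_frame t a b K y =
    (if t = 0 then ev (push 4 y 0 K) a b
     else if t = 1 then ev K a y
     else if t = 2 then
       ev K a (prod_encode (fst (prod_decode b), prod_encode (snd (prod_decode b), y)))
     else if t = 3 then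
       (if y = 0 then ret K (snd (prod_decode b))
        else ev (push 3 a (prod_encode (fst (prod_decode b), Suc (snd (prod_decode b)))) K) a
          (prod_encode (fst (prod_decode b), Suc (snd (prod_decode b)))))
     else ret K (prod_encode (a, y)))"

text \<open>A value returned to the empty stack is a fixed point, so running too long does no
  harm.\<close>

definition step :: "baire \<Rightarrow> nat \<Rightarrow> nat" where
  "step r s = (let K = fst (prod_decode (snd (prod_decode s))); v = snd (prod_decode (snd (prod_decode s))) in
    if fst (prod_decode s) = 0 then step_ev r K (fst (prod_decode v)) (snd (prod_decode v))
    else if K = 0 then s
    else let f = fst (prod_decode (K - 1)) in
      step_frame (fst (prod_decode f)) (fst (prod_decode (snd (prod_decode f))))
        (snd (prod_decode (snd (prod_decode f)))) (snd (prod_decode (K - 1))) v)"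

lemma computable_op_step: "computable_op step"
  unfolding step_def step_ev_def step_frame_def Let_def ev_def ret_def push_def
  by (intro computable_op_intros)

lemma step_ev: "step r (ev K n x) = step_ev r K n x"
  by (simp add: step_def ev_def)

lemma step_ret_push: "step r (ret (push t a b K) y) = step_frame t a b K y"
  by (simp add: step_def ret_def push_def)

lemma nth_prog_cases:
  obtains "n = 0" "nth_prog n = Zero" | "n = 1" "nth_prog n = Succ" | "n = 2" "nth_prog n = Fst"
  | "n = 3" "nth_prog n = Snd" | "n = 4" "nth_prog n = Query"
  | a b where "n = 4 * prod_encode (a, b) + 5" "nth_prog n = Pair (nth_prog a) (nth_prog b)"
  | a b where "n = 4 * prod_encode (a, b) + 6" "nth_prog n = Comp (nth_prog a) (nth_prog b)"
  | a b where "n = 4 * prod_encode (a, b) + 7" "nth_prog n = PrimRec (nth_prog a) (nth_prog b)"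
  | a where "n = 4 * a + 8" "nth_prog n = Search (nth_prog a)"
proof (cases "n < 5")
  case True
  then consider "n = 0" | "n = 1" | "n = 2" | "n = 3" | "n = 4" by linarith
  then show ?thesis by cases (use that in \<open>auto simp: nth_prog.simps\<close>)
next
  case False
  define t where "t = (n - 5) mod 4"
  obtain a b where ab: "(n - 5) div 4 = prod_encode (a, b)"
    by (metis prod_decode_inverse surj_pair)
  have n: "n = 4 * prod_encode (a, b) + t + 5"
    using False unfolding t_def ab[symmetric] by simp
  have "t < 4" unfolding t_def by simp
  then consider "t = 0" | "t = 1" | "t = 2" | "t = 3" by linarith
  then show ?thesis
    using nth_prog_Suc5[OF \<open>t < 4\<close>, of a b] that(6-9) unfolding n[symmetric]
    by cases (use n in auto)
qed

lemma reaches_trans: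
  "\<exists>t. (f ^^ t) a = b \<Longrightarrow> \<exists>t. (f ^^ t) b = c \<Longrightarrow> \<exists>t. (f ^^ t) a = c"
  by (metis comp_apply funpow_add add.commute)

lemma reaches_step: "\<exists>t. (f ^^ t) (f a) = b \<Longrightarrow> \<exists>t. (f ^^ t) a = b"
  by (metis comp_apply funpow_Suc_right)

text \<open>Induction on the computation with the stack \<open>K\<close> arbitrary: each
  subcomputation returns its value to the frame pushed for it and leaves the rest of the stack
  intact, so the runs can be concatenated.\<close>

lemma stack_machine_correct:
  "computes r c x y \<Longrightarrow> nth_prog n = c \<Longrightarrow> \<exists>t. (step r ^^ t) (ev K n x) = ret K y"
proof (induction arbitrary: n K rule: computes.induct)
  case (Pair f x y g z)
  then obtain a b where n: "n = 4 * prod_encode (a, b) + 5" "nth_prog a = f" "nth_prog b = g"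
    by (cases n rule: nth_prog_cases) auto
  have "\<exists>t. (step r ^^ t) (ev (push 0 b x K) a x) = ret (push 0 b x K) y"
    using n(2) by (rule Pair.IH)
  moreover have "\<exists>t. (step r ^^ t) (ret (push 0 b x K) y) = ret (push 4 y 0 K) z"
    using Pair.IH(2)[OF n(3)]
    by - (rule reaches_step, simp add: step_ret_push step_frame_def)
  moreover have "\<exists>t. (step r ^^ t) (ret (push 4 y 0 K) z) = ret K (prod_encode (y, z))"
    by (rule exI[of _ 1]) (simp add: step_ret_push step_frame_def)
  ultimately have "\<exists>t. (step r ^^ t) (ev (push 0 b x K) a x) = ret K (prod_encode (y, z))"
    by (rule reaches_trans[OF reaches_trans])
  then show ?case
    by - (rule reaches_step[of _ "ev K n x"], simp add: step_ev step_ev_def n(1) div_Suc mod_Suc)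
next
  case (Comp g x y f z)
  then obtain a b where n: "n = 4 * prod_encode (a, b) + 6" "nth_prog a = f" "nth_prog b = g"
    by (cases n rule: nth_prog_cases) auto
  have "\<exists>t. (step r ^^ t) (ev (push 1 a 0 K) b x) = ret (push 1 a 0 K) y"
    using n(3) by (rule Comp.IH)
  moreover have "\<exists>t. (step r ^^ t) (ret (push 1 a 0 K) y) = ret K z"
    using Comp.IH(2)[OF n(2)]
    by - (rule reaches_step, simp add: step_ret_push step_frame_def)
  ultimately have "\<exists>t. (step r ^^ t) (ev (push 1 a 0 K) b x) = ret K z"
    by (rule reaches_trans)
  then show ?case
    by - (rule reaches_step[of _ "ev K n x"], simp add: step_ev step_ev_def n(1) div_Suc mod_Suc)
next
  case (PrimRec_0 f x y g)
  then obtain a b where n: "n = 4 * prod_encode (a, b) + 7" "nth_prog a = f" "nth_prog b = g"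
    by (cases n rule: nth_prog_cases) auto
  show ?case
    using PrimRec_0.IH[OF n(2)]
    by - (rule reaches_step[of _ "ev K n _"], simp add: step_ev step_ev_def n(1) div_Suc mod_Suc)
next
  case (PrimRec_Suc f g x k y z)
  then obtain a b where n: "n = 4 * prod_encode (a, b) + 7" "nth_prog a = f" "nth_prog b = g"
    by (cases n rule: nth_prog_cases) auto
  let ?K = "push 2 b (prod_encode (x, k)) K"
  have "\<exists>t. (step r ^^ t) (ev ?K n (prod_encode (x, k))) = ret ?K y"
    using PrimRec_Suc.prems by (rule PrimRec_Suc.IH)
  moreover have "\<exists>t. (step r ^^ t) (ret ?K y) = ret K z"
    using PrimRec_Suc.IH(2)[OF n(3)]
    by - (rule reaches_step, simp add: step_ret_push step_frame_def)
  ultimately have "\<exists>t. (step r ^^ t) (ev ?K n (prod_encode (x, k))) = ret K z"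
    by (rule reaches_trans)
  then show ?case
    by - (rule reaches_step[of _ "ev K n _"], simp add: step_ev step_ev_def n(1) div_Suc mod_Suc)
next
  case (Search f x k)
  then obtain a where n: "n = 4 * a + 8" "nth_prog a = f"
    by (cases n rule: nth_prog_cases) auto
  let ?K = "\<lambda>m. push 3 a (prod_encode (x, m)) K"
  \<comment> \<open>Each candidate below \<open>k\<close> yields a positive value, which moves the
    frame on to the next candidate.\<close>
  have "\<exists>t. (step r ^^ t) (ev (?K 0) a (prod_encode (x, 0))) = ev (?K m) a (prod_encode (x, m))"
    if "m \<le> k" for m
    using that
  proof (induction m)
    case 0
    show ?case by (rule exI[of _ 0]) simp
  next
    case (Suc m)
    then have "m < k" by simp
    then obtain y where y: "\<And>n K. nth_prog n = f \<Longrightarrow>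
        \<exists>t. (step r ^^ t) (ev K n (prod_encode (x, m))) = ret K (Suc y)"
      using Search.IH(2) by blast
    have "\<exists>t. (step r ^^ t) (ev (?K m) a (prod_encode (x, m))) = ret (?K m) (Suc y)"
      by (rule y[OF n(2)])
    moreover have "\<exists>t. (step r ^^ t) (ret (?K m) (Suc y)) = ev (?K (Suc m)) a (prod_encode (x, Suc m))"
      by (rule exI[of _ 1]) (simp add: step_ret_push step_frame_def)
    ultimately show ?case by (intro reaches_trans[OF reaches_trans[OF Suc.IH]]) (use \<open>m < k\<close> in auto)
  qed
  from this[OF order_refl] Search.IH(1)[OF n(2)]
  have "\<exists>t. (step r ^^ t) (ev (?K 0) a (prod_encode (x, 0))) = ret (?K k) 0"
    by (rule reaches_trans)
  moreover have "\<exists>t. (step r ^^ t) (ret (?K k) 0) = ret K k"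
    by (rule exI[of _ 1]) (simp add: step_ret_push step_frame_def)
  ultimately have "\<exists>t. (step r ^^ t) (ev (?K 0) a (prod_encode (x, 0))) = ret K k"
    by (rule reaches_trans)
  then show ?case
    by - (rule reaches_step[of _ "ev K n _"], simp add: step_ev step_ev_def n(1) div_Suc mod_Suc)
next
  case (Zero x)
  then have "n = 0" by (cases n rule: nth_prog_cases) auto
  then show ?case by (simp add: exI[of _ 1] step_ev step_ev_def)
next
  case (Succ x)
  then have "n = 1" by (cases n rule: nth_prog_cases) auto
  then show ?case by (simp add: exI[of _ 1] step_ev step_ev_def)
next
  case (Fst x y)
  then have "n = 2" by (cases n rule: nth_prog_cases) auto
  then show ?case by (simp add: exI[of _ 1] step_ev step_ev_def)
next
  case (Snd x y)
  then have "n = 3" by (cases n rule: nth_prog_cases) auto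
  then show ?case by (simp add: exI[of _ 1] step_ev step_ev_def)
next
  case (Query x)
  then have "n = 4" by (cases n rule: nth_prog_cases) auto
  then show ?case by (simp add: exI[of _ 1] step_ev step_ev_def)
qed

text \<open>Totality of \<open>h\<close> supplies the positive values below the least zero that the
  rule for \<open>Search\<close> requires.\<close>

lemma computes_Search_total:
  assumes "\<And>n. computes r c (prod_encode (x, n)) (h n)" "h n = 0"
  shows "computes r (Search c) x (LEAST n. h n = 0)"
proof (rule computes.Search)
  show "computes r c (prod_encode (x, LEAST n. h n = 0)) 0"
    using assms(1)[of "LEAST n. h n = 0"] LeastI[of "\<lambda>n. h n = 0", OF assms(2)] by simp
  show "\<forall>m<LEAST n. h n = 0. \<exists>y. computes r c (prod_encode (x, m)) (Suc y)"
    using assms(1) not_less_Least by (metis not0_implies_Suc)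
qed

text \<open>Iterating \<open>step\<close> is a primitive recursion; a search finds a number of steps
  after which the machine has halted, and the value is read off that state.\<close>

lemma universal_program:
  "\<exists>u. \<forall>r n x y. computes r (nth_prog n) x y \<longrightarrow> computes r u (prod_encode (n, x)) y"
proof -
  define run where "run r z t =
    rec_nat (ev 0 (fst (prod_decode z)) (snd (prod_decode z))) (\<lambda>_ s. step r s) t" for r z t
  have run_eq: "run r (prod_encode (n, x)) t = (step r ^^ t) (ev 0 n x)" for r n x t
    unfolding run_def by (induction t) auto
  \<comment> \<open>This is 0 exactly when a value has been returned to the empty stack: in a
    returning state it is the code of the stack itself.\<close>
  define running where "running s = (if fst (prod_decode s) = 0 then 1
    else fst (prod_decode (snd (prod_decode s))))" for s
  have run: "computable_op (\<lambda>r w. run r (fst (prod_decode w)) (snd (prod_decode w)))"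
    unfolding run_def ev_def
    by (intro computable_op_rec computable_op_comp[OF computable_op_step] computable_op_intros)
  have "computable_op (\<lambda>r w. running (run r (fst (prod_decode w)) (snd (prod_decode w))))"
    unfolding running_def by (intro computable_op_intros run)
  then obtain h where h: "computes r h w (running (run r (fst (prod_decode w)) (snd (prod_decode w))))"
    for r w unfolding computable_op_def by blast
  have "computable_op (\<lambda>r w. snd (prod_decode (snd (prod_decode (run r (fst (prod_decode w)) (snd (prod_decode w)))))))"
    by (intro computable_op_intros run)
  then obtain g where g: "computes r g w
    (snd (prod_decode (snd (prod_decode (run r (fst (prod_decode w)) (snd (prod_decode w)))))))"
    for r w unfolding computable_op_def by blast
  have "computes r (Comp g (Pair prog_id (Search h))) (prod_encode (n, x)) y"
    if c: "computes r (nth_prog n) x y" for r n x y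
  proof -
    let ?s = "\<lambda>t. run r (prod_encode (n, x)) t"
    obtain t where t: "?s t = ret 0 y"
      using stack_machine_correct[OF c refl] unfolding run_eq by blast
    then have t0: "running (?s t) = 0" by (simp add: running_def ret_def)
    define l where "l = (LEAST t. running (?s t) = 0)"
    have l: "running (?s l) = 0" "l \<le> t"
      unfolding l_def using t0 by (rule LeastI, rule Least_le)
    \<comment> \<open>The search stops at the least halting time \<open>l\<close>, possibly before
      \<open>t\<close>; the state at \<open>l\<close> is a fixed point and hence equals the one at
      \<open>t\<close>.\<close>
    have "fst (prod_decode (?s l)) \<noteq> 0" "fst (prod_decode (snd (prod_decode (?s l)))) = 0"
      using l(1) unfolding running_def by (auto split: if_splits)
    then have fixpoint: "step r (?s l) = ?s l" by (simp add: step_def)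
    have "?s (l + k) = ?s l" for k
      by (induction k) (use fixpoint in \<open>auto simp: run_def\<close>)
    with t l(2) have "?s l = ret 0 y" by (metis le_add_diff_inverse)
    then have "computes r g (prod_encode (prod_encode (n, x), l)) y"
      using g[of r "prod_encode (prod_encode (n, x), l)"] by (simp add: ret_def)
    moreover have "computes r (Search h) (prod_encode (n, x)) l"
      unfolding l_def
    proof (rule computes_Search_total)
      show "computes r h (prod_encode (prod_encode (n, x), m)) (running (?s m))" for m
        using h[of r "prod_encode (prod_encode (n, x), m)"] by simp
    qed (rule t0)
    ultimately show ?thesis by (meson computes.Comp computes.Pair computes_id)
  qed
  then show ?thesis by blast
qed

section \<open>Computable functions on Baire space\<close>

lemma baire_fun_eq_Some: "baire_fun c r = Some q \<longleftrightarrow> (\<forall>n. computes r c n (q n))"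
proof
  assume "baire_fun c r = Some q"
  then show "\<forall>n. computes r c n (q n)"
    unfolding baire_fun_def by (auto split: if_splits) (metis computes_deterministic the_equality)
next
  assume q: "\<forall>n. computes r c n (q n)"
  then have "(THE y. computes r c n y) = q n" for n
    by (meson computes_deterministic the_equality)
  with q show "baire_fun c r = Some q" unfolding baire_fun_def by auto
qed

lemma computable_baire_fun_iff:
  "computable_baire_fun F \<longleftrightarrow> (\<exists>c. \<forall>r q. F r = Some q \<longrightarrow> (\<forall>n. computes r c n (q n)))"
proof -
  have "F \<subseteq>\<^sub>m baire_fun c \<longleftrightarrow> (\<forall>r q. F r = Some q \<longrightarrow> baire_fun c r = Some q)" for c
    by (fastforce simp: map_le_def dom_def)
  then show ?thesis unfolding computable_baire_fun_def baire_fun_eq_Some by simp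
qed

lemma computable_baire_fun_index:
  assumes "computable_baire_fun F"
  obtains n where "\<And>r q. F r = Some q \<Longrightarrow> baire_fun (nth_prog n) r = Some q"
  using assms surj_nth_prog unfolding computable_baire_fun_iff baire_fun_eq_Some
  by (metis surj_def)

lemma computable_baire_fun_total: "computable_op f \<Longrightarrow> computable_baire_fun (\<lambda>r. Some (f r))"
  unfolding computable_baire_fun_iff computable_op_def by auto

section \<open>Closure of computable partial functions under composition, joins, cases and
  tupling\<close>

lemma computable_baire_fun_bind:
  assumes "computable_baire_fun F" "computable_baire_fun G"
  shows "computable_baire_fun (\<lambda>r. Option.bind (F r) G)"
proof -
  obtain c d where c: "\<And>r q. F r = Some q \<Longrightarrow> \<forall>n. computes r c n (q n)"
    and d: "\<And>r q. G r = Some q \<Longrightarrow> \<forall>n. computes r d n (q n)"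
    using assms unfolding computable_baire_fun_iff by blast
  \<comment> \<open>The intermediate oracle does not depend on the parameter:
    \<open>Comp c Snd\<close> discards it, and the dummy 0 is supplied below.\<close>
  obtain e where e: "\<And>r i s x y. \<forall>z. computes r (Comp c Snd) (prod_encode (i, z)) (s z) \<Longrightarrow>
      computes s d x y \<Longrightarrow> computes r e (prod_encode (i, x)) y"
    using oracle_substitution by metis
  have "computes r (Comp e (Pair Zero prog_id)) n (q n)" if "Option.bind (F r) G = Some q" for r q n
  proof -
    from that obtain p where p: "F r = Some p" "G p = Some q" by (auto simp: bind_eq_Some_conv)
    have "\<forall>z. computes r (Comp c Snd) (prod_encode (0, z)) (p z)"
      using c[OF p(1)] by (meson computes.Comp computes.Snd)
    from e[OF this, of n "q n"] d[OF p(2)] show ?thesis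
      by (meson computes.Comp computes.Pair computes.Zero computes_id)
  qed
  then show ?thesis unfolding computable_baire_fun_iff by blast
qed

lemma computable_baire_fun_comp:
  "computable_baire_fun F \<Longrightarrow> computable_op f \<Longrightarrow> computable_baire_fun (\<lambda>r. F (f r))"
  using computable_baire_fun_bind[OF computable_baire_fun_total, of f F] by simp

lemma computable_baire_fun_map:
  "computable_baire_fun F \<Longrightarrow> computable_op f \<Longrightarrow> computable_baire_fun (\<lambda>r. map_option f (F r))"
  using computable_baire_fun_bind[OF _ computable_baire_fun_total, of F f]
  by (simp add: map_conv_bind_option comp_def)

text \<open>Both functions are evaluated at \<open>n div 2\<close> and the parity of
  \<open>n\<close> selects a value, so both have to be defined.\<close>

lemma computable_baire_fun_join:
  assumes "computable_baire_fun F" "computable_baire_fun G"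
  shows "computable_baire_fun (\<lambda>r. Option.bind (F r) (\<lambda>p. map_option (join p) (G r)))"
proof -
  obtain c d where c: "\<And>r q. F r = Some q \<Longrightarrow> \<forall>n. computes r c n (q n)"
    and d: "\<And>r q. G r = Some q \<Longrightarrow> \<forall>n. computes r d n (q n)"
    using assms unfolding computable_baire_fun_iff by blast
  have "computable_op (\<lambda>r n. n div 2)"
    by (intro computable_op_intros)
  then obtain h where h: "\<And>r n. computes r h n (n div 2)"
    unfolding computable_op_def by blast
  have "computable_op (\<lambda>r z. if even (fst (prod_decode z)) then fst (prod_decode (snd (prod_decode z)))
      else snd (prod_decode (snd (prod_decode z))))"
    by (intro computable_op_intros)
  then obtain s where s: "\<And>r z. computes r s z (if even (fst (prod_decode z))
      then fst (prod_decode (snd (prod_decode z))) else snd (prod_decode (snd (prod_decode z))))"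
    unfolding computable_op_def by blast
  have "computes r (Comp s (Pair prog_id (Pair (Comp c h) (Comp d h)))) n (join p q n)"
    if "F r = Some p" "G r = Some q" for r p q n
  proof (rule computes.Comp)
    show "computes r (Pair prog_id (Pair (Comp c h) (Comp d h))) n
        (prod_encode (n, prod_encode (p (n div 2), q (n div 2))))"
      using c[OF that(1)] d[OF that(2)] h by (meson computes.Comp computes.Pair computes_id)
    show "computes r s (prod_encode (n, prod_encode (p (n div 2), q (n div 2)))) (join p q n)"
      using s[of r "prod_encode (n, prod_encode (p (n div 2), q (n div 2)))"]
      by (cases "even n") (simp_all add: join_def)
  qed
  then show ?thesis
    unfolding computable_baire_fun_iff
    by (intro exI[of _ "Comp s (Pair prog_id (Pair (Comp c h) (Comp d h)))"])
      (auto simp: bind_eq_Some_conv)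
qed

lemma join_left [simp]: "join p q (2 * n) = p n"
  and join_right [simp]: "join p q (Suc (2 * n)) = q n"
  by (simp_all add: join_def)

text \<open>The pairing lets the continuation \<open>G\<close> still refer to the original oracle.\<close>

lemma computable_baire_fun_bind2:
  assumes F: "computable_baire_fun F"
    and G: "computable_baire_fun (\<lambda>j. G (\<lambda>n. j (2 * n)) (\<lambda>n. j (Suc (2 * n))))"
  shows "computable_baire_fun (\<lambda>r. Option.bind (F r) (G r))"
proof -
  have "computable_baire_fun (\<lambda>r. Option.bind (Option.bind (Some r) (\<lambda>p. map_option (join p) (F r)))
      (\<lambda>j. G (\<lambda>n. j (2 * n)) (\<lambda>n. j (Suc (2 * n)))))"
    by (intro computable_baire_fun_bind computable_baire_fun_join computable_baire_fun_total
        computable_op_oracle F G)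
  then show ?thesis by (simp add: map_conv_bind_option)
qed

text \<open>The index may depend on the oracle, which is where the universal program enters.\<close>

lemma computable_baire_fun_eval:
  assumes "computable_op (\<lambda>r x. n r)"
  shows "computable_baire_fun (\<lambda>r. baire_fun (nth_prog (n r)) r)"
proof -
  obtain u where u: "\<And>r n x y. computes r (nth_prog n) x y \<Longrightarrow> computes r u (prod_encode (n, x)) y"
    using universal_program by metis
  obtain c where c: "\<And>r x. computes r c x (n r)"
    using assms unfolding computable_op_def by blast
  have "computes r (Comp u (Pair c prog_id)) x (q x)" if "baire_fun (nth_prog (n r)) r = Some q" for r q x
    using that c u unfolding baire_fun_eq_Some by (meson computes.Comp computes.Pair computes_id)
  then show ?thesis unfolding computable_baire_fun_iff by blast
qed

text \<open>The branch not taken may diverge, so the branches must not both be run. The test selects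
  an index first, and only that program is executed.\<close>

lemma computable_baire_fun_if_0:
  assumes n: "computable_op (\<lambda>r x. n r)" and F: "computable_baire_fun F" and G: "computable_baire_fun G"
  shows "computable_baire_fun (\<lambda>r. if n r = 0 then F r else G r)"
proof -
  obtain k where k: "\<And>r q. F r = Some q \<Longrightarrow> baire_fun (nth_prog k) r = Some q"
    using computable_baire_fun_index[OF F] by blast
  obtain m where m: "\<And>r q. G r = Some q \<Longrightarrow> baire_fun (nth_prog m) r = Some q"
    using computable_baire_fun_index[OF G] by blast
  have "computable_baire_fun (\<lambda>r. baire_fun (nth_prog (if n r = 0 then k else m)) r)"
    by (intro computable_baire_fun_eval computable_op_if_0 n computable_op_const)
  then obtain c where c: "\<And>r q. baire_fun (nth_prog (if n r = 0 then k else m)) r = Some q \<Longrightarrow>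
      \<forall>x. computes r c x (q x)"
    unfolding computable_baire_fun_iff by blast
  have "\<forall>x. computes r c x (q x)" if "(if n r = 0 then F r else G r) = Some q" for r q
    by (rule c) (use that k m in \<open>auto split: if_splits\<close>)
  then show ?thesis unfolding computable_baire_fun_iff by blast
qed

lemma computable_baire_fun_tuple:
  assumes "computable_baire_fun F"
  shows "computable_baire_fun (\<lambda>r. if \<forall>i. F (prepend i r) \<noteq> None
    then Some (tuple (\<lambda>i. the (F (prepend i r)))) else None)"
proof -
  obtain c where c: "\<And>r q. F r = Some q \<Longrightarrow> \<forall>n. computes r c n (q n)"
    using assms unfolding computable_baire_fun_iff by blast
  have "computable_op (\<lambda>r z. if snd (prod_decode z) = 0 then fst (prod_decode z) else r (snd (prod_decode z) - 1))"
    by (intro computable_op_intros)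
  then obtain d where d': "\<And>r z. computes r d z (if snd (prod_decode z) = 0 then fst (prod_decode z)
      else r (snd (prod_decode z) - 1))"
    unfolding computable_op_def by blast
  have d: "computes r d (prod_encode (i, z)) (prepend i r z)" for r i z
    using d'[of r "prod_encode (i, z)"] by (cases z) (simp_all add: prepend_def)
  \<comment> \<open>Here the oracle varies with the input: digit \<open>(i, k)\<close> of the tuple
    is digit \<open>k\<close> of \<open>F\<close> at \<open>prepend i r\<close>, uniformly in
    \<open>i\<close>.\<close>
  obtain e where e: "\<And>r i s x y. \<forall>z. computes r d (prod_encode (i, z)) (s z) \<Longrightarrow>
      computes s c x y \<Longrightarrow> computes r e (prod_encode (i, x)) y"
    using oracle_substitution by metis
  have "computes r e n (tuple (\<lambda>i. the (F (prepend i r))) n)" if "\<forall>i. F (prepend i r) \<noteq> None" for r n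
  proof -
    obtain i k where n: "n = prod_encode (i, k)" by (metis prod_decode_inverse surj_pair)
    have "computes (prepend i r) c k (the (F (prepend i r)) k)"
      using c that by (metis option.collapse)
    then show ?thesis unfolding n tuple_def by (simp add: e[OF allI[OF d]])
  qed
  then show ?thesis unfolding computable_baire_fun_iff by auto
qed

text \<open>
  An oracle for a self-referential function is \<open>prepend e p\<close> with \<open>e\<close> an index of the
  function itself, so that no recursion theorem is needed.
\<close>

definition self :: "baire \<rightharpoonup> baire" where
  "self r = baire_fun (nth_prog (r 0)) r"

lemma computable_self: "computable_baire_fun self"
  unfolding self_def by (intro computable_baire_fun_eval computable_op_query computable_op_const)

text \<open>In the applications \<open>F\<close> itself calls \<open>self\<close> on oracles with
  the same first entry; once that entry is \<open>e\<close>, such a call runs \<open>F\<close>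
  again.\<close>

lemma self_index:
  assumes "computable_baire_fun F"
  obtains e where "\<And>p q. F (prepend e p) = Some q \<Longrightarrow> self (prepend e p) = Some q"
proof -
  obtain e where "\<And>r q. F r = Some q \<Longrightarrow> baire_fun (nth_prog e) r = Some q"
    using computable_baire_fun_index[OF assms] by blast
  then have "self (prepend e p) = Some q" if "F (prepend e p) = Some q" for p q
    using that unfolding self_def by (simp add: prepend_def)
  with that show thesis by blast
qed

lemma prepend_0 [simp]: "prepend a p 0 = a"
  and prepend_Suc [simp]: "prepend a p (Suc n) = p n"
  and tail_prepend [simp]: "tail (prepend a p) = p"
  by (simp_all add: prepend_def tail_def)

lemma computable_prepend_query:
  assumes "computable_baire_fun F"
  shows "computable_baire_fun (\<lambda>r. map_option (prepend (r k)) (F r))"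
  unfolding map_conv_bind_option comp_def
  by (intro computable_baire_fun_bind2 computable_baire_fun_total assms computable_op_intros)

section \<open>Represented spaces\<close>

lemma computable_map_iff:
  "computable_map \<delta>X \<delta>Y f \<longleftrightarrow> (\<exists>F. computable_baire_fun F \<and>
    (\<forall>p x. \<delta>X p = Some x \<longrightarrow> (\<exists>q. F p = Some q \<and> \<delta>Y q = Some (f x))))"
  unfolding computable_map_def computable_multi_def realizer_def by simp

section \<open>Names of functions and their evaluation\<close>

definition fun_name :: "nat \<Rightarrow> baire \<Rightarrow> baire" where
  "fun_name n p = (prepend 0 ^^ n) (prepend 1 p)"

lemma fun_name_0: "fun_name 0 p = prepend 1 p"
  and fun_name_Suc: "fun_name (Suc n) p = prepend 0 (fun_name n p)"
  by (simp_all add: fun_name_def)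

lemma fun_name_nth: "fun_name n p k = (if k < n then 0 else if k = n then 1 else p (k - Suc n))"
proof (induction n arbitrary: k)
  case 0
  then show ?case by (cases k) (auto simp: fun_name_0)
next
  case (Suc n)
  then show ?case by (cases k) (auto simp: fun_name_Suc)
qed

lemma computable_op_fun_name:
  assumes "computable_op p"
  shows "computable_op (\<lambda>r x. fun_name n (p r) x)"
proof (induction n)
  case 0
  show ?case unfolding fun_name_0 by (intro computable_op_prepend computable_op_const assms)
next
  case (Suc n)
  then show ?case unfolding fun_name_Suc by (intro computable_op_prepend computable_op_const)
qed

lemma rep_fun_eq_Some: "rep_fun \<delta>X \<delta>Y r = Some f \<longleftrightarrow> names_fun \<delta>X \<delta>Y r f"
proof
  show "rep_fun \<delta>X \<delta>Y r = Some f \<Longrightarrow> names_fun \<delta>X \<delta>Y r f"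
    unfolding rep_fun_def by (auto split: if_splits) (metis names_fun_unique the_equality)
  show "names_fun \<delta>X \<delta>Y r f \<Longrightarrow> rep_fun \<delta>X \<delta>Y r = Some f"
    unfolding rep_fun_def by (auto intro: names_fun_unique)
qed

text \<open>Every number has a \<open>rep_nat\<close>-name, so extensionality is vacuous; every
  \<open>q\<close> is a name of \<open>q 0\<close>, so the machine must succeed for all
  \<open>q\<close>.\<close>

lemma rep_fun_nat_eq_Some:
  "rep_fun rep_nat \<delta> r = Some f \<longleftrightarrow> (\<exists>n p. r = fun_name n p \<and>
    (\<forall>q. \<exists>u. baire_fun (nth_prog n) (join p q) = Some u \<and> \<delta> u = Some (f (q 0))))"
proof -
  have "\<exists>p. rep_nat p = Some x" for x
    unfolding rep_nat_def by auto
  then have "ran rep_nat = UNIV" unfolding ran_def by auto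
  then show ?thesis
    unfolding rep_fun_eq_Some names_fun_def realizer_def fun_name_def
    by (simp add: rep_nat_def)
qed

text \<open>The index \<open>n\<close> is recovered from \<open>fun_name n p\<close> by searching for the first nonzero entry.\<close>

lemma computable_apply:
  obtains A where "computable_baire_fun A"
    "\<And>n p i. A (prepend i (fun_name n p)) = baire_fun (nth_prog n) (join p (\<lambda>_. i))"
proof -
  define index where "index r = (LEAST k. r (Suc k) \<noteq> 0)" for r :: baire
  define S where "S r = (if \<exists>k. r (Suc k) \<noteq> 0 then Some (prepend (index r) r) else None)" for r :: baire
  \<comment> \<open>After \<open>S\<close> the oracle reads \<open>n\<close>, \<open>i\<close>, then
    \<open>n\<close> zeros, a 1 and \<open>p\<close>, so \<open>p\<close> starts at position
    \<open>n + 3\<close>. The constant sequence serves as a name of \<open>i\<close>.\<close>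
  define f where "f r = prepend (r 0) (join (\<lambda>k. r (Suc (Suc (Suc (r 0 + k))))) (\<lambda>_. r (Suc 0)))" for r :: baire
  have "computable_baire_fun S"
  proof -
    have "computable_op (\<lambda>r z. if r (Suc (snd (prod_decode z))) = 0 then 1 else 0)"
      by (intro computable_op_intros)
    then obtain c where c: "\<And>r z. computes r c z (if r (Suc (snd (prod_decode z))) = 0 then 1 else 0)"
      unfolding computable_op_def by blast
    have "computable_op (\<lambda>r z. if snd (prod_decode z) = 0 then fst (prod_decode z) else r (snd (prod_decode z) - 1))"
      by (intro computable_op_intros)
    then obtain d where d: "\<And>r z. computes r d z (if snd (prod_decode z) = 0 then fst (prod_decode z)
        else r (snd (prod_decode z) - 1))"
      unfolding computable_op_def by blast
    have "computes r (Comp d (Pair (Search c) prog_id)) x (prepend (index r) r x)"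
      if "r (Suc k) \<noteq> 0" for r k x
    proof -
      have "computes r (Search c) x (LEAST n. (if r (Suc n) = 0 then 1 else 0 :: nat) = 0)"
        using c[of r "prod_encode (x, _)"] that by (intro computes_Search_total[of _ _ _ _ k]) auto
      moreover have "(LEAST n. (if r (Suc n) = 0 then 1 else 0 :: nat) = 0) = index r"
        unfolding index_def by (rule arg_cong[of _ _ Least]) auto
      moreover have "prepend (index r) r x = (if x = 0 then index r else r (x - 1))"
        by (cases x) auto
      ultimately show ?thesis
        using d[of r "prod_encode (index r, x)"]
        by (auto intro!: computes.Comp[of _ _ _ "prod_encode (index r, x)"] computes.Pair computes_id)
    qed
    then show ?thesis unfolding computable_baire_fun_iff S_def by auto
  qed
  moreover have "computable_op f"
    unfolding f_def by (intro computable_op_intros)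
  \<comment> \<open>The program now runs on the tail, not on the oracle holding its index; oracle
    substitution into the universal program bridges this.\<close>
  moreover have "computable_baire_fun (\<lambda>r. baire_fun (nth_prog (r 0)) (tail r))"
  proof -
    obtain u where u: "\<And>r n x y. computes r (nth_prog n) x y \<Longrightarrow> computes r u (prod_encode (n, x)) y"
      using universal_program by metis
    have "computable_op (\<lambda>r z. r (Suc (snd (prod_decode z))))"
      by (intro computable_op_intros)
    then obtain d where d: "\<And>r z. computes r d z (r (Suc (snd (prod_decode z))))"
      unfolding computable_op_def by blast
    obtain e where e: "\<And>r i s x y. \<forall>z. computes r d (prod_encode (i, z)) (s z) \<Longrightarrow>
        computes s u x y \<Longrightarrow> computes r e (prod_encode (i, x)) y"
      using oracle_substitution by metis
    have "computes r (Comp e (Pair Zero (Pair (Comp Query Zero) prog_id))) x (q x)"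
      if "baire_fun (nth_prog (r 0)) (tail r) = Some q" for r q x
    proof (rule computes.Comp)
      show "computes r (Pair Zero (Pair (Comp Query Zero) prog_id)) x
          (prod_encode (0, prod_encode (r 0, x)))"
        by (intro computes.Pair computes.Zero computes_id) (meson computes.intros)
      have "\<forall>z. computes r d (prod_encode (0, z)) (tail r z)"
        using d[of r "prod_encode (0, _)"] by (simp add: tail_def)
      then show "computes r e (prod_encode (0, prod_encode (r 0, x))) (q x)"
        by (rule e) (use u that in \<open>simp add: baire_fun_eq_Some\<close>)
    qed
    then show ?thesis unfolding computable_baire_fun_iff by blast
  qed
  ultimately have "computable_baire_fun (\<lambda>r. Option.bind (map_option f (S r))
      (\<lambda>r. baire_fun (nth_prog (r 0)) (tail r)))"
    by (intro computable_baire_fun_bind[OF computable_baire_fun_map])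
  moreover have *: "map_option f (S (prepend i (fun_name n p))) = Some (prepend n (join p (\<lambda>_. i)))" for i n p
  proof -
    have "index (prepend i (fun_name n p)) = n"
      unfolding index_def by (rule Least_equality) (auto simp: fun_name_nth split: if_splits)
    moreover have "prepend i (fun_name n p) (Suc n) \<noteq> 0" by (simp add: fun_name_nth)
    ultimately have "S (prepend i (fun_name n p)) = Some (prepend n (prepend i (fun_name n p)))"
      unfolding S_def by auto
    then show ?thesis by (simp add: f_def fun_name_nth)
  qed
  ultimately show thesis
    by (intro that) (auto simp only: * bind.bind_lunit prepend_0 tail_prepend)
qed

section \<open>Countable ordinals\<close>

lemma \<delta>_nK_eq_Some: "\<delta>_nK p = Some a \<longleftrightarrow> nK_name p a"
proof
  show "\<delta>_nK p = Some a \<Longrightarrow> nK_name p a"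
    unfolding \<delta>_nK_def by (auto split: if_splits) (metis nK_name_unique the_equality)
  show "nK_name p a \<Longrightarrow> \<delta>_nK p = Some a"
    unfolding \<delta>_nK_def by (auto intro: nK_name_unique)
qed

lemma nK_name_zeros: "nK_name (\<lambda>_. 0) 0"
proof -
  have "prepend 0 (\<lambda>_. 0) = (\<lambda>_. 0)"
    by (rule ext) (simp add: prepend_def split: nat.split)
  then show ?thesis using nK_name.zero[of "\<lambda>_. 0"] by simp
qed

lemma less_cord_SUP_iff: "b < (SUP i. f i) \<longleftrightarrow> (\<exists>i. b < f i)" for f :: "nat \<Rightarrow> cord"
  using less_cSUP_iff[OF _ bdd_above_range_cord] by blast

lemma less_cord_succ_iff: "b < cord_succ a \<longleftrightarrow> b \<le> a"
  using cord_succ_greater cord_succ_least by (meson le_less_trans not_le)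

text \<open>A realizer is constrained only where the value is nonempty. \<open>Skip\<close> is what
  makes \<open>Lower 0\<close> nonempty; otherwise the countable set of predecessors is
  enumerated.\<close>

lemma Lower_nonempty: "Lower a \<noteq> {}"
proof (cases "{..<a} = {}")
  case True
  then have "(\<lambda>_. Skip) \<in> Lower a" unfolding Lower_def by auto
  then show ?thesis by blast
next
  case False
  then have "range (from_nat_into {..<a}) = {..<a}"
    using countable_cord_below by (rule range_from_nat_into)
  then have "(\<lambda>i. Inr (from_nat_into {..<a} i)) \<in> Lower a"
    unfolding Lower_def by (simp add: set_eq_iff image_iff eq_commute)
  then show ?thesis by blast
qed

lemma Lower_less: "s \<in> Lower a \<Longrightarrow> s i = Inr b \<Longrightarrow> b < a"
  unfolding Lower_def by blast

text \<open>An ordinal is the least upper bound of the successors of its predecessors, uniformly for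
  zero, successors and limits. \<open>Skip\<close> contributes 0, which leaves the supremum
  unchanged.\<close>

lemma Lower_SUP:
  assumes "s \<in> Lower a"
  shows "(SUP i. case s i of Inl _ \<Rightarrow> 0 | Inr b \<Rightarrow> cord_succ b) = a"
proof (rule antisym)
  show "(SUP i. case s i of Inl _ \<Rightarrow> 0 | Inr b \<Rightarrow> cord_succ b) \<le> a"
    using Lower_less[OF assms]
    by (intro cSUP_least) (auto split: sum.split intro: zero_le_cord cord_succ_least)
  have "b < (SUP i. case s i of Inl _ \<Rightarrow> 0 | Inr b \<Rightarrow> cord_succ b)" if "b < a" for b
  proof -
    obtain i where "s i = Inr b" using assms \<open>b < a\<close> unfolding Lower_def by blast
    then have "b < (case s i of Inl _ \<Rightarrow> 0 | Inr b \<Rightarrow> cord_succ b)" by (simp add: cord_succ_greater)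
    then show ?thesis unfolding less_cord_SUP_iff by blast
  qed
  then show "a \<le> (SUP i. case s i of Inl _ \<Rightarrow> 0 | Inr b \<Rightarrow> cord_succ b)"
    by (meson less_irrefl not_le)
qed

section \<open>From the operations to the two translations\<close>

lemma computable_map_from_nK:
  assumes "computable_point \<delta> 0" "computable_map \<delta> \<delta> cord_succ"
    "computable_map (rep_fun rep_nat \<delta>) \<delta> (\<lambda>\<alpha>. SUP i. \<alpha> i)"
  shows "computable_map \<delta>_nK \<delta> id"
proof -
  obtain c z where z: "baire_fun c (\<lambda>_. 0) = Some z" "\<delta> z = Some 0"
    using assms(1) unfolding computable_point_def computable_baire_def by blast
  have c: "computable_baire_fun (baire_fun c)"
    unfolding computable_baire_fun_def by (blast intro: map_le_refl)
  obtain S where S: "computable_baire_fun S"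
    "\<And>p x. \<delta> p = Some x \<Longrightarrow> \<exists>q. S p = Some q \<and> \<delta> q = Some (cord_succ x)"
    using assms(2) unfolding computable_map_iff by blast
  obtain P where P: "computable_baire_fun P"
    "\<And>p f. rep_fun rep_nat \<delta> p = Some f \<Longrightarrow> \<exists>q. P p = Some q \<and> \<delta> q = Some (SUP i. f i)"
    using assms(3) unfolding computable_map_iff by blast
  \<comment> \<open>On \<open>join (prepend e (tuple ps)) q\<close> this reads \<open>e\<close> at 0
    and \<open>i = q 0\<close> at 1, and extracts \<open>ps i\<close> from the later even positions.
    It is the recursive call for the \<open>i\<close>-th member of a supremum. As \<open>e\<close>
    is read from the oracle, the index of \<open>M\<close> can be fixed before
    \<open>e\<close>.\<close>
  define M where "M j = self (prepend (j 0) (\<lambda>k. j (2 * Suc (prod_encode (j (Suc 0), k)))))" for j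
  have "computable_baire_fun M"
    unfolding M_def by (intro computable_baire_fun_comp[OF computable_self] computable_op_intros)
  then obtain n where n: "\<And>r q. M r = Some q \<Longrightarrow> baire_fun (nth_prog n) r = Some q"
    using computable_baire_fun_index by metis
  \<comment> \<open>The oracle consists of \<open>e\<close>, the leading tag of the
    \<open>\<delta>_nK\<close>-name, and the rest of the name. A supremum is not evaluated member by
    member: \<open>P\<close> receives a name of the sequence, with machine \<open>n\<close> doing
    the recursive calls on demand.\<close>
  define G where "G r = (if r (Suc 0) = 0 then baire_fun c (\<lambda>_. 0)
    else if r (Suc 0) - 1 = 0 then Option.bind (self (prepend (r 0) (tail (tail r)))) S
    else P (fun_name n (prepend (r 0) (tail (tail r)))))" for r
  have G: "computable_baire_fun G"
    unfolding G_def
    by (intro computable_baire_fun_if_0 computable_baire_fun_bind S(1)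
        computable_baire_fun_comp[OF computable_self] computable_baire_fun_comp[OF P(1)]
        computable_baire_fun_comp[OF c] computable_op_fun_name computable_op_intros)
  then obtain e where e: "\<And>p q. G (prepend e p) = Some q \<Longrightarrow> self (prepend e p) = Some q"
    by (metis self_index)
  have "\<exists>q. G (prepend e p) = Some q \<and> \<delta> q = Some a" if "nK_name p a" for p a
    using that
  proof induction
    case (zero p)
    show ?case using z by (simp add: G_def)
  next
    case (succ p a)
    then obtain q where q: "G (prepend e p) = Some q" "\<delta> q = Some a" by blast
    have "G (prepend e (prepend 1 p)) = S q" using e[OF q(1)] by (simp add: G_def)
    with S(2)[OF q(2)] show ?case by simp
  next
    case (sup ps a)
    have "rep_fun rep_nat \<delta> (fun_name n (prepend e (tuple ps))) = Some a"
      unfolding rep_fun_nat_eq_Some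
    proof (rule exI, rule exI, intro conjI allI)
      fix q :: baire
      obtain u where u: "G (prepend e (ps (q 0))) = Some u" "\<delta> u = Some (a (q 0))"
        using sup.IH by blast
      have "M (join (prepend e (tuple ps)) q) = self (prepend e (ps (q 0)))"
        using join_left[of "prepend e (tuple ps)" q "Suc _"] join_left[of "prepend e (tuple ps)" q 0]
          join_right[of "prepend e (tuple ps)" q 0]
        by (simp add: M_def tuple_def del: join_left join_right mult_Suc_right)
      then have "baire_fun (nth_prog n) (join (prepend e (tuple ps)) q) = Some u"
        using n e[OF u(1)] by simp
      with u(2) show "\<exists>u. baire_fun (nth_prog n) (join (prepend e (tuple ps)) q) = Some u \<and>
          \<delta> u = Some (a (q 0))" by blast
    qed simp
    moreover have "G (prepend e (prepend 2 (tuple ps))) = P (fun_name n (prepend e (tuple ps)))"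
      by (simp add: G_def)
    ultimately show ?case using P(2) by simp
  qed
  moreover have "computable_baire_fun (\<lambda>p. G (prepend e p))"
    by (intro computable_baire_fun_comp[OF G] computable_op_intros)
  ultimately show ?thesis
    unfolding computable_map_iff \<delta>_nK_eq_Some id_apply by blast
qed

text \<open>The translation of a name of \<open>a\<close> calls itself only on names of ordinals
  listed by \<open>Lower\<close>, which are below \<open>a\<close>; well-founded induction shows
  that it is defined.\<close>

lemma computable_map_to_nK:
  assumes "computable_multi \<delta> (rep_fun rep_nat (rep_sum rep_unit \<delta>)) Lower"
  shows "computable_map \<delta> \<delta>_nK id"
proof -
  obtain L where L: "computable_baire_fun L"
    "\<And>p a. \<delta> p = Some a \<Longrightarrow>
      \<exists>m s. L p = Some m \<and> rep_fun rep_nat (rep_sum rep_unit \<delta>) m = Some s \<and> s \<in> Lower a"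
    using assms Lower_nonempty unfolding computable_multi_def realizer_def by blast
  obtain A where A: "computable_baire_fun A"
    "\<And>n p i. A (prepend i (fun_name n p)) = baire_fun (nth_prog n) (join p (\<lambda>_. i))"
    using computable_apply by blast
  \<comment> \<open>The oracle \<open>r\<close> is \<open>i\<close>, \<open>e\<close>,
    \<open>p\<close>. \<open>Skip\<close> becomes the all-zero name of 0, and a listed ordinal
    becomes 1 followed by its recursive translation, a name of its successor.\<close>
  define K where "K r u = (if u 0 = 0 then Some (\<lambda>_. 0)
    else map_option (prepend 1) (self (prepend (r (Suc 0)) (tail u))))" for r u :: baire
  define t where "t r = Option.bind (Option.bind (map_option (prepend (r 0)) (L (tail (tail r)))) A) (K r)" for r
  have t: "computable_baire_fun t"
    unfolding t_def K_def
    by (intro computable_baire_fun_bind2 computable_baire_fun_bind A(1) computable_prepend_query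
        computable_baire_fun_comp[OF L(1)] computable_baire_fun_if_0 computable_baire_fun_total
        computable_baire_fun_map computable_baire_fun_comp[OF computable_self] computable_op_intros)
  define G where "G r = map_option (prepend 2) (if \<forall>i. t (prepend i r) \<noteq> None
    then Some (tuple (\<lambda>i. the (t (prepend i r)))) else None)" for r
  have G: "computable_baire_fun G"
    unfolding G_def by (intro computable_baire_fun_map computable_baire_fun_tuple t computable_op_intros)
  then obtain e where e: "\<And>p q. G (prepend e p) = Some q \<Longrightarrow> self (prepend e p) = Some q"
    by (metis self_index)
  have "\<exists>q. G (prepend e p) = Some q \<and> nK_name q a" if "\<delta> p = Some a" for p a
    using that
  proof (induction a arbitrary: p rule: less_induct)
    case (less a)
    obtain m s where m: "L p = Some m" "rep_fun rep_nat (rep_sum rep_unit \<delta>) m = Some s" "s \<in> Lower a"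
      using L(2)[OF less.prems] by blast
    have "\<exists>q. t (prepend i (prepend e p)) = Some q \<and>
        nK_name q (case s i of Inl _ \<Rightarrow> 0 | Inr b \<Rightarrow> cord_succ b)" for i
    proof -
      obtain n p' where "m = fun_name n p'"
        "\<forall>q. \<exists>u. baire_fun (nth_prog n) (join p' q) = Some u \<and> rep_sum rep_unit \<delta> u = Some (s (q 0))"
        using m(2) unfolding rep_fun_nat_eq_Some by blast
      then obtain u where u: "A (prepend i m) = Some u" "rep_sum rep_unit \<delta> u = Some (s i)"
        using A(2) by fastforce
      have tu: "t (prepend i (prepend e p)) = K (prepend i (prepend e p)) u"
        using m(1) u(1) by (simp add: t_def)
      show ?thesis
      proof (cases "s i")
        case (Inl x)
        then have "u 0 = 0" using u(2) by (auto simp: rep_sum_def split: if_splits)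
        then show ?thesis using tu Inl nK_name_zeros by (simp add: K_def)
      next
        case (Inr b)
        then have u': "u 0 = 1" "\<delta> (tail u) = Some b"
          using u(2) by (auto simp: rep_sum_def split: if_splits)
        obtain q where q: "G (prepend e (tail u)) = Some q" "nK_name q b"
          using less.IH[OF Lower_less[OF m(3) Inr] u'(2)] by blast
        then show ?thesis
          using tu Inr u'(1) e[OF q(1)] nK_name.succ[OF q(2)] by (simp add: K_def)
      qed
    qed
    then obtain qs where qs: "\<And>i. t (prepend i (prepend e p)) = Some (qs i)"
      "\<And>i. nK_name (qs i) (case s i of Inl _ \<Rightarrow> 0 | Inr b \<Rightarrow> cord_succ b)"
      by metis
    have "G (prepend e p) = Some (prepend 2 (tuple qs))"
      by (simp add: G_def qs(1))
    moreover have "nK_name (prepend 2 (tuple qs)) a"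
      using nK_name.sup[of qs, OF qs(2)] unfolding Lower_SUP[OF m(3)] .
    ultimately show ?case by blast
  qed
  moreover have "computable_baire_fun (\<lambda>p. G (prepend e p))"
    by (intro computable_baire_fun_comp[OF G] computable_op_intros)
  ultimately show ?thesis
    unfolding computable_map_iff \<delta>_nK_eq_Some id_apply by blast
qed

section \<open>From the isomorphism to the operations\<close>

lemma nK_Lower:
  obtains E where "computable_baire_fun E"
    "\<And>p a. nK_name p a \<Longrightarrow>
      \<exists>s\<in>Lower a. \<forall>i. \<exists>q. E (prepend i p) = Some q \<and> rep_sum rep_unit \<delta>_nK q = Some (s i)"
proof -
  \<comment> \<open>The oracle is \<open>e\<close>, the position \<open>i\<close>, the tag and the
    rest of the name. For 0 the zero sequence names \<open>Skip\<close>. For a successor, position 0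
    lists the predecessor itself and later positions shift down by one. For a supremum,
    \<open>i\<close> codes \<open>(j, k)\<close> and entry \<open>k\<close> of member
    \<open>j\<close> is requested.\<close>
  define G where "G r = (if r 2 = 0 then Some (\<lambda>_. 0)
    else if r 2 - 1 = 0 then
      (if r (Suc 0) = 0 then Some (prepend 1 (tail (tail (tail r))))
       else self (prepend (r 0) (prepend (r (Suc 0) - 1) (tail (tail (tail r))))))
    else self (prepend (r 0) (prepend (snd (prod_decode (r (Suc 0))))
      (\<lambda>k. r (Suc (Suc (Suc (prod_encode (fst (prod_decode (r (Suc 0))), k)))))))))" for r
  have G: "computable_baire_fun G"
    unfolding G_def
    by (intro computable_baire_fun_if_0 computable_baire_fun_total
        computable_baire_fun_comp[OF computable_self] computable_op_intros)
  then obtain e where e: "\<And>p q. G (prepend e p) = Some q \<Longrightarrow> self (prepend e p) = Some q"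
    by (metis self_index)
  have "\<exists>s\<in>Lower a. \<forall>i. \<exists>q. G (prepend e (prepend i p)) = Some q \<and>
      rep_sum rep_unit \<delta>_nK q = Some (s i)" if "nK_name p a" for p a
    using that
  proof induction
    case (zero p)
    have "(\<lambda>_. Skip) \<in> Lower 0"
      unfolding Lower_def using zero_le_cord by (auto simp: not_less)
    then show ?case
      by (rule bexI[rotated]) (simp add: G_def numeral_2_eq_2 rep_sum_def rep_unit_def)
  next
    case (succ p a)
    then obtain s where s: "s \<in> Lower a" "\<And>i. \<exists>q. G (prepend e (prepend i p)) = Some q \<and>
      rep_sum rep_unit \<delta>_nK q = Some (s i)" by blast
    have "case_nat (Inr a) s \<in> Lower (cord_succ a)"
    proof -
      have "b < cord_succ a \<longleftrightarrow> (\<exists>i. case_nat (Inr a) s i = Inr b)" for b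
      proof -
        have "(\<exists>i. case_nat (Inr a) s i = Inr b) \<longleftrightarrow> a = b \<or> (\<exists>i. s i = Inr b)"
          by (metis not0_implies_Suc old.nat.simps(4,5) sum.inject(2))
        with s(1) show ?thesis
          unfolding less_cord_succ_iff Lower_def by (auto simp: order.order_iff_strict)
      qed
      then show ?thesis unfolding Lower_def by blast
    qed
    moreover have "\<exists>q. G (prepend e (prepend i (prepend 1 p))) = Some q \<and>
      rep_sum rep_unit \<delta>_nK q = Some (case_nat (Inr a) s i)" for i
    proof (cases i)
      case 0
      have "\<delta>_nK p = Some a" using succ.hyps by (simp add: \<delta>_nK_eq_Some)
      with 0 show ?thesis by (simp add: G_def numeral_2_eq_2 rep_sum_def)
    next
      case (Suc j)
      obtain q where "G (prepend e (prepend j p)) = Some q" "rep_sum rep_unit \<delta>_nK q = Some (s j)"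
        using s(2) by blast
      with Suc e show ?thesis by (simp add: G_def numeral_2_eq_2)
    qed
    ultimately show ?case by blast
  next
    case (sup ps a)
    then obtain s where s: "\<And>j. s j \<in> Lower (a j)"
      "\<And>j i. \<exists>q. G (prepend e (prepend i (ps j))) = Some q \<and> rep_sum rep_unit \<delta>_nK q = Some (s j i)"
      by metis
    define s' where "s' i = s (fst (prod_decode i)) (snd (prod_decode i))" for i
    have "s' \<in> Lower (SUP i. a i)"
    proof -
      have "(\<exists>i. s' i = Inr b) \<longleftrightarrow> (\<exists>j i. s j i = Inr b)" for b
        unfolding s'_def by (metis fst_conv snd_conv prod_encode_inverse)
      then show ?thesis
        using s(1) unfolding Lower_def less_cord_SUP_iff by blast
    qed
    moreover have "\<exists>q. G (prepend e (prepend i (prepend 2 (tuple ps)))) = Some q \<and>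
      rep_sum rep_unit \<delta>_nK q = Some (s' i)" for i
    proof -
      obtain j k where i: "i = prod_encode (j, k)" by (metis prod_decode_inverse surj_pair)
      obtain q where q: "G (prepend e (prepend k (ps j))) = Some q" "rep_sum rep_unit \<delta>_nK q = Some (s j k)"
        using s(2) by blast
      have "G (prepend e (prepend i (prepend 2 (tuple ps)))) = self (prepend e (prepend k (ps j)))"
        by (simp add: G_def i tuple_def numeral_2_eq_2)
      with q e show ?thesis by (simp add: s'_def i)
    qed
    ultimately show ?case by blast
  qed
  moreover have "computable_baire_fun (\<lambda>p. G (prepend e p))"
    by (intro computable_baire_fun_comp[OF G] computable_op_intros)
  ultimately show thesis by (rule that[rotated]) auto
qed

text \<open>Each operation is conjugated: \<open>T\<close> translates arguments to
  \<open>\<delta>_nK\<close>, where the operation acts on names, and \<open>T'\<close> translates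
  results back.\<close>

lemma computable_operations_nK_iso:
  assumes "computable_map \<delta> \<delta>_nK id" "computable_map \<delta>_nK \<delta> id"
  shows computable_zero_nK_iso: "computable_point \<delta> 0"
    and computable_succ_nK_iso: "computable_map \<delta> \<delta> cord_succ"
    and computable_SUP_nK_iso: "computable_map (rep_fun rep_nat \<delta>) \<delta> (\<lambda>\<alpha>. SUP i. \<alpha> i)"
    and computable_Lower_nK_iso: "computable_multi \<delta> (rep_fun rep_nat (rep_sum rep_unit \<delta>)) Lower"
proof -
  obtain T where T: "computable_baire_fun T"
    "\<And>p a. \<delta> p = Some a \<Longrightarrow> \<exists>q. T p = Some q \<and> nK_name q a"
    using assms(1) unfolding computable_map_iff \<delta>_nK_eq_Some id_apply by blast
  obtain T' where T': "computable_baire_fun T'"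
    "\<And>p a. nK_name p a \<Longrightarrow> \<exists>q. T' p = Some q \<and> \<delta> q = Some a"
    using assms(2) unfolding computable_map_iff \<delta>_nK_eq_Some id_apply by blast

  show "computable_point \<delta> 0"
  proof -
    \<comment> \<open>The zero oracle used for computable points is itself a
      \<open>\<delta>_nK\<close>-name of 0.\<close>
    obtain q where "T' (\<lambda>_. 0) = Some q" "\<delta> q = Some 0"
      using T'(2)[OF nK_name_zeros] by blast
    then show ?thesis
      using T'(1) unfolding computable_point_def computable_baire_def
      by (metis computable_baire_fun_index)
  qed

  show "computable_map \<delta> \<delta> cord_succ"
  proof -
    have "computable_baire_fun (\<lambda>r. Option.bind (map_option (prepend 1) (T r)) T')"
      by (intro computable_baire_fun_bind computable_baire_fun_map T(1) T'(1) computable_op_intros)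
    moreover have "\<exists>q. Option.bind (map_option (prepend 1) (T p)) T' = Some q \<and> \<delta> q = Some (cord_succ a)"
      if "\<delta> p = Some a" for p a
      using T(2)[OF that] T'(2) nK_name.succ by fastforce
    ultimately show ?thesis unfolding computable_map_iff by blast
  qed

  show "computable_map (rep_fun rep_nat \<delta>) \<delta> (\<lambda>\<alpha>. SUP i. \<alpha> i)"
  proof -
    obtain A where A: "computable_baire_fun A"
      "\<And>n p i. A (prepend i (fun_name n p)) = baire_fun (nth_prog n) (join p (\<lambda>_. i))"
      using computable_apply by blast
    define t where "t r = Option.bind (A r) T" for r
    define F where "F r = Option.bind (map_option (prepend 2) (if \<forall>i. t (prepend i r) \<noteq> None
      then Some (tuple (\<lambda>i. the (t (prepend i r)))) else None)) T'" for r
    have "computable_baire_fun F"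
      unfolding F_def
      by (intro computable_baire_fun_bind computable_baire_fun_map computable_baire_fun_tuple T'(1) computable_op_intros)
        (unfold t_def, intro computable_baire_fun_bind A(1) T(1))
    moreover have "\<exists>q. F r = Some q \<and> \<delta> q = Some (SUP i. f i)" if r: "rep_fun rep_nat \<delta> r = Some f" for r f
    proof -
      obtain n p where p: "r = fun_name n p"
        "\<forall>q. \<exists>u. baire_fun (nth_prog n) (join p q) = Some u \<and> \<delta> u = Some (f (q 0))"
        using r unfolding rep_fun_nat_eq_Some by blast
      have "\<exists>q. t (prepend i r) = Some q \<and> nK_name q (f i)" for i
      proof -
        obtain u where u: "A (prepend i r) = Some u" "\<delta> u = Some (f i)"
          using p A(2) by fastforce
        with T(2)[OF u(2)] show ?thesis by (auto simp: t_def)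
      qed
      then obtain qs where qs: "\<And>i. t (prepend i r) = Some (qs i)" "\<And>i. nK_name (qs i) (f i)"
        by metis
      have "F r = T' (prepend 2 (tuple qs))" by (simp add: F_def qs(1))
      with T'(2)[OF nK_name.sup[of qs, OF qs(2)]] show ?thesis by simp
    qed
    ultimately show ?thesis unfolding computable_map_iff by blast
  qed

  show "computable_multi \<delta> (rep_fun rep_nat (rep_sum rep_unit \<delta>)) Lower"
  proof -
    obtain E where E: "computable_baire_fun E" "\<And>p a. nK_name p a \<Longrightarrow>
      \<exists>s\<in>Lower a. \<forall>i. \<exists>q. E (prepend i p) = Some q \<and> rep_sum rep_unit \<delta>_nK q = Some (s i)"
      using nK_Lower by blast
    define K where "K u = (if u 0 = 0 then Some u else map_option (prepend 1) (T' (tail u)))" for u :: baire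
    \<comment> \<open>On \<open>join p q\<close> the even part is \<open>p\<close> and entry 1 is
      \<open>q 0\<close>, so the answer depends on \<open>q\<close> only through the number it
      names. The listed sequence may depend on the name \<open>p\<close>, as multivaluedness
      allows.\<close>
    define M where "M j = Option.bind (Option.bind (map_option (prepend (j (Suc 0))) (T (\<lambda>k. j (2 * k)))) E) K"
      for j
    have "computable_baire_fun M"
      unfolding M_def
      by (intro computable_baire_fun_bind computable_prepend_query computable_baire_fun_comp[OF T(1)] E(1)
          computable_op_intros)
        (unfold K_def, intro computable_baire_fun_if_0 computable_baire_fun_total computable_baire_fun_map
          computable_baire_fun_comp[OF T'(1)] computable_op_intros)
    then obtain n where n: "\<And>r q. M r = Some q \<Longrightarrow> baire_fun (nth_prog n) r = Some q"
      using computable_baire_fun_index by metis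
    have "\<exists>s. rep_fun rep_nat (rep_sum rep_unit \<delta>) (fun_name n p) = Some s \<and> s \<in> Lower a"
      if p: "\<delta> p = Some a" for p a
    proof -
      obtain p' where p': "T p = Some p'" "nK_name p' a" using T(2)[OF p] by blast
      obtain s where s: "s \<in> Lower a"
        "\<And>i. \<exists>q. E (prepend i p') = Some q \<and> rep_sum rep_unit \<delta>_nK q = Some (s i)"
        using E(2)[OF p'(2)] by blast
      have "\<exists>u. baire_fun (nth_prog n) (join p q) = Some u \<and> rep_sum rep_unit \<delta> u = Some (s (q 0))" for q
      proof -
        obtain v where v: "E (prepend (q 0) p') = Some v" "rep_sum rep_unit \<delta>_nK v = Some (s (q 0))"
          using s(2) by blast
        have "M (join p q) = K v"
          using join_right[of p q 0] p'(1) v(1) by (simp add: M_def)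
        moreover have "\<exists>u. K v = Some u \<and> rep_sum rep_unit \<delta> u = Some (s (q 0))"
        proof (cases "v 0 = 0")
          case True
          with v(2) show ?thesis by (simp add: K_def rep_sum_def rep_unit_def)
        next
          case False
          then obtain b where b: "s (q 0) = Inr b" "nK_name (tail v) b"
            using v(2) unfolding rep_sum_def by (auto simp: \<delta>_nK_eq_Some dest: sym split: if_splits)
          then obtain w where "T' (tail v) = Some w" "\<delta> w = Some b" using T'(2) by blast
          with False b(1) show ?thesis by (simp add: K_def rep_sum_def)
        qed
        ultimately show ?thesis using n by metis
      qed
      then have "rep_fun rep_nat (rep_sum rep_unit \<delta>) (fun_name n p) = Some s"
        unfolding rep_fun_nat_eq_Some by blast
      with s(1) show ?thesis by blast
    qed
    \<comment> \<open>All work is left to machine \<open>n\<close>; the realizer of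
      \<open>Lower\<close> only puts \<open>n\<close> zeros and a 1 in front of
      \<open>p\<close>.\<close>
    moreover have "computable_baire_fun (\<lambda>p. Some (fun_name n p))"
      by (intro computable_baire_fun_total computable_op_fun_name computable_op_oracle)
    ultimately show ?thesis
      unfolding computable_multi_def realizer_def by blast
  qed
qed

theorem theorem8:
  fixes \<delta> :: "cord representation"
  assumes "ran \<delta> = UNIV"
  shows
    "(computable_map \<delta> \<delta>_nK id \<and> computable_map \<delta>_nK \<delta> id) \<longleftrightarrow>
     (computable_point \<delta> 0 \<and>
      computable_map \<delta> \<delta> cord_succ \<and>
      computable_map (rep_fun rep_nat \<delta>) \<delta> (\<lambda>\<alpha>. SUP i. \<alpha> i) \<and>
      computable_multi \<delta> (rep_fun rep_nat (rep_sum rep_unit \<delta>)) Lower)"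
  using computable_operations_nK_iso computable_map_from_nK computable_map_to_nK by blast

end
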